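(* Let $\Omega\subset\mathbb{R}^2$ be open, $(\Omega_n)_{n\in\mathbb{N}}$ a family of non-empty open sets with $\Omega_n\subset\Omega_{n+1}$ for all $n$ and $\Omega=\bigcup_{n\in\mathbb{N}}\Omega_n$, and $\mathcal{V}=(\nu_n)_{n\in\mathbb{N}}$ a directed family of continuous weights on $\Omega$. Let $n\in\mathbb{N}$. If Condition (D) (see context) with $I_{214}(k)\ge I_{14}(k+1)$ for all $k\in\mathbb{N}$ and $(\omega.1)$ (see context) hold, then, with $m:=2J_1(I_{14}(n))$, the set $\pi_n(\mathcal{OV}(\Omega))$ is dense in $\pi_{m,n}(\mathcal{O}\nu_m(\Omega_m))$ with respect to the norm $|\cdot|_n$, where $$\pi_n\colon\mathcal{OV}(\Omega)\to\mathcal{O}\nu_n(\Omega_n),\ \pi_n(f):=f_{\mid\Omega_n},\qquad \pi_{m,n}\colon\mathcal{O}\nu_m(\Omega_m)\to\mathcal{O}\nu_n(\Omega_n),\ \pi_{m,n}(f):=f_{\mid\Omega_n}.$$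
   Context: $\mathbb{N}=\{1,2,\dots\}$, $\mathbb{R}^2$ is identified with $\mathbb{C}$. $|\cdot|$ is the Euclidean norm, $\|\cdot\|_\infty$ the sup-norm on $\mathbb{R}^2$, $\mathbb{B}_r(x)$ the open Euclidean ball; $\mathrm{d}^{\|\cdot\|}(M_0,M_1)=\inf_{x\in M_0,y\in M_1}\|x-y\|$ for non-empty sets, and $\infty$ if one of them is empty; $M^C=\mathbb{R}^2\setminus M$. **Spaces.** A directed family of continuous weights on $\Omega$ is a sequence $(\nu_n)_{n\in\mathbb{N}}$ of continuous functions $\nu_n\colon\Omega\to(0,\infty)$ with $\nu_n\le\nu_{n+1}$. $\mathcal{O}\nu_n(\Omega_n)$ is the space of holomorphic $f\colon\Omega_n\to\mathbb{C}$ with $|f|_n:=\sup_{x\in\Omega_n}|f(x)|\nu_n(x)<\infty$. $\mathcal{OV}(\Omega)$ is the space of holomorphic $f\colon\Omega\to\mathbb{C}$ with $f_{\mid\Omega_n}\in\mathcal{O}\nu_n(\Omega_n)$ for all $n\in\mathbb{N}$. **$(\omega.1)$.** For every $k\in\mathbb{N}$ there is $\rho_k\in\mathbb{R}$ with $0<\rho_k<\mathrm{d}^{\|\cdot\|_\infty}(\{x\},\partial\Omega_{k+1})$ for all $x\in\Omega_k$ such that for any $n\in\mathbb{N}$ there are a natural number $J_1(n)\ge n$ and $C_1(n)>0$ such that for all $x\in\Omega_k$: $\sup_{\|\zeta\|_\infty\le\rho_k}\nu_n(x+\zeta)\le C_1(n)\inf_{\|\zeta\|_\infty\le\rho_k}\nu_{J_1(n)}(x+\zeta)$.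 If $J_1(n)$ is chosen depending on $k$, then $J_1(n)$ in the claim denotes the choice for $k=n$ (so $J_1(I_{14}(n))$ is the choice for $k$ and weight index both equal to $I_{14}(n)$). **Condition (D).** $\Omega_n\neq\mathbb{R}^2$ for all $n$, $\mathrm{d}^{|\cdot|}(\Omega_n,\partial\Omega_k)>0$ for all $k>n$, and: a) For every $n\in\mathbb{N}$ there are an entire function $g_n$ with $g_n(0)=1$ and natural numbers $I_1(n),I_2(n)>n$ such that (i) for every $\varepsilon>0$ there is a compact set $K\subset\overline{\Omega}_n$ with $\nu_n(x)\le\varepsilon\nu_{I_1(n)}(x)$ for all $x\in\Omega_n\setminus K$; (ii) there is an open set $X_{I_2(n)}\subset\mathbb{R}^2\setminus\overline{\Omega}_{I_2(n)}$ and, with $\mathrm{d}_{X,I_2(n)}:=\mathrm{d}^{|\cdot|}(X_{I_2(n)},\Omega_{I_2(n)})$, there are $R_n,r_n\in\mathbb{R}$ with $0<2R_n<\mathrm{d}_{X,I_2(n)}$ and $R_n<r_n<\mathrm{d}_{X,I_2(n)}-R_n$, and a function $A_2(\cdot,n)\colon X_{I_2(n)}+\mathbb{B}_{R_n}(0)\to(0,\infty)$ whose restriction to $X_{I_2(n)}$ is locally bounded, such that $\max\{|g_n(\zeta)|\nu_{I_2(n)}(z) : \zeta\in\mathbb{R}^2,\ |\zeta-(z-x)|=r_n\}\le A_2(x,n)$ for all $z\in\Omega_{I_2(n)}$ and $x\in X_{I_2(n)}+\mathbb{B}_{R_n}(0)$; (iii) for every compact $K\subset\mathbb{R}^2$ there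 is $A_3(n,K)>0$ with $\int_K\frac{|g_n(x-y)|\nu_n(x)}{|x-y|}\,dy\le A_3(n,K)$ for all $x\in\Omega_n$. b) For every $n\in\mathbb{N}$ there are a natural number $I_4(n)>n$ and $A_4(n)>0$ such that, with $I_{14}(n):=I_1(I_4(n))$, $\int_{\Omega_{I_4(n)}}\frac{|g_{I_{14}(n)}(x-y)|\nu_p(x)}{|x-y|\nu_k(y)}\,dy\le A_4(n)$ for all $x\in\Omega_p$, for $(k,p)=(I_4(n),n)$ and for $(k,p)=(I_{14}(n),I_{14}(n))$. c) With $I_{214}(n):=I_2(I_{14}(n))$: for every $n\in\mathbb{N}$, every closed $M\subset\overline{\Omega}_n$ and every connected component $N$ of $M^C$, if $N\cap\overline{\Omega}_n^{\,C}\ne\varnothing$ then $N\cap X_{I_{214}(n)}\neq\varnothing$ (where $X_{I_{214}(n)}$ is the set from a)(ii) for the index $I_{14}(n)$). *)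

theory Defs
  imports "HOL-Analysis.Analysis"
begin

text \<open>
  The plane is the type \<^typ>\<open>complex\<close>, whose \<^const>\<open>infnorm\<close> is the maximum of the absolute values
  of the real and imaginary part. All sequences are indexed by the natural numbers
  1, 2, 3, ...; the value at index 0 is never used.
\<close>

definition set_distance :: "(complex \<Rightarrow> real) \<Rightarrow> complex set \<Rightarrow> complex set \<Rightarrow> ereal" where
  \<comment> \<open>Unlike \<^const>\<open>setdist\<close>, this is \<open>\<infinity>\<close> if one of the sets is empty.\<close>
  "set_distance nrm A B = (INF x\<in>A. INF y\<in>B. ereal (nrm (x - y)))"

definition locally_bounded_on :: "complex set \<Rightarrow> (complex \<Rightarrow> real) \<Rightarrow> bool" where
  "locally_bounded_on S f \<longleftrightarrow> (\<forall>x\<in>S. \<exists>U. open U \<and> x \<in> U \<and> bounded (f ` (U \<inter> S)))"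

definition directed_weights :: "complex set \<Rightarrow> (nat \<Rightarrow> complex \<Rightarrow> real) \<Rightarrow> bool" where
  "directed_weights \<Omega> \<nu> \<longleftrightarrow>
     (\<forall>n\<ge>1. continuous_on \<Omega> (\<nu> n) \<and> (\<forall>x\<in>\<Omega>. 0 < \<nu> n x \<and> \<nu> n x \<le> \<nu> (n + 1) x))"

definition weighted_norm :: "complex set \<Rightarrow> (complex \<Rightarrow> real) \<Rightarrow> (complex \<Rightarrow> complex) \<Rightarrow> ereal" where
  "weighted_norm S w f = (SUP x\<in>S. ereal (cmod (f x) * w x))"

text \<open>Functions on \<open>S\<close> are total functions that are \<^const>\<open>undefined\<close> outside of \<open>S\<close>.\<close>

definition weighted_hol :: "complex set \<Rightarrow> (complex \<Rightarrow> real) \<Rightarrow> (complex \<Rightarrow> complex) set" where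
  "weighted_hol S w = {f \<in> extensional S. f holomorphic_on S \<and> weighted_norm S w f < \<infinity>}"

definition weighted_hol_proj ::
  "complex set \<Rightarrow> (nat \<Rightarrow> complex set) \<Rightarrow> (nat \<Rightarrow> complex \<Rightarrow> real) \<Rightarrow> (complex \<Rightarrow> complex) set" where
  "weighted_hol_proj \<Omega> \<Omega>s \<nu> =
     {f \<in> extensional \<Omega>. f holomorphic_on \<Omega> \<and>
        (\<forall>n\<ge>1. restrict f (\<Omega>s n) \<in> weighted_hol (\<Omega>s n) (\<nu> n))}"

definition dense_wrt ::
  "((complex \<Rightarrow> complex) \<Rightarrow> ereal) \<Rightarrow> (complex \<Rightarrow> complex) set \<Rightarrow> (complex \<Rightarrow> complex) set \<Rightarrow> bool" where
  "dense_wrt nrm A B \<longleftrightarrow>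
     A \<subseteq> B \<and> (\<forall>b\<in>B. \<forall>\<epsilon>>0. \<exists>a\<in>A. nrm (\<lambda>x. b x - a x) < ereal \<epsilon>)"

definition omega_1 ::
  "(nat \<Rightarrow> complex set) \<Rightarrow> (nat \<Rightarrow> complex \<Rightarrow> real) \<Rightarrow> (nat \<Rightarrow> nat \<Rightarrow> nat) \<Rightarrow> bool" where
  \<comment> \<open>\<open>J\<^sub>1 k n\<close> is the index chosen for the set \<open>\<Omega>s k\<close> and the weight \<open>\<nu> n\<close>.\<close>
  "omega_1 \<Omega>s \<nu> J\<^sub>1 \<longleftrightarrow>
     (\<forall>k\<ge>1. \<exists>\<rho>::real.
        0 < \<rho> \<and>
        (\<forall>x\<in>\<Omega>s k. ereal \<rho> < set_distance infnorm {x} (frontier (\<Omega>s (k + 1)))) \<and>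
        (\<forall>n\<ge>1. J\<^sub>1 k n \<ge> n \<and>
           (\<exists>C>0. \<forall>x\<in>\<Omega>s k.
              (SUP \<zeta>\<in>{\<zeta>. infnorm \<zeta> \<le> \<rho>}. \<nu> n (x + \<zeta>))
                \<le> C * (INF \<zeta>\<in>{\<zeta>. infnorm \<zeta> \<le> \<rho>}. \<nu> (J\<^sub>1 k n) (x + \<zeta>)))))"

text \<open>
  In the following conditions \<open>X n\<close> is the open set belonging to the index \<open>n\<close>; it lies in the
  complement of the closure of \<open>\<Omega>s (I\<^sub>2 n)\<close>. The quotients by \<open>cmod (x - y)\<close> take the value 0 at
  \<open>y = x\<close>, which does not affect the integrals.
\<close>

definition condition_D_a ::
  "(nat \<Rightarrow> complex set) \<Rightarrow> (nat \<Rightarrow> complex \<Rightarrow> real) \<Rightarrow> (nat \<Rightarrow> complex \<Rightarrow> complex)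
     \<Rightarrow> (nat \<Rightarrow> nat) \<Rightarrow> (nat \<Rightarrow> nat) \<Rightarrow> (nat \<Rightarrow> complex set) \<Rightarrow> bool" where
  "condition_D_a \<Omega>s \<nu> g I\<^sub>1 I\<^sub>2 X \<longleftrightarrow>
     (\<forall>n\<ge>1.
        g n holomorphic_on UNIV \<and> g n 0 = 1 \<and> I\<^sub>1 n > n \<and> I\<^sub>2 n > n \<and>
        (\<forall>\<epsilon>>0. \<exists>K. compact K \<and> K \<subseteq> closure (\<Omega>s n) \<and>
           (\<forall>x \<in> \<Omega>s n - K. \<nu> n x \<le> \<epsilon> * \<nu> (I\<^sub>1 n) x)) \<and>
        (open (X n) \<and> X n \<subseteq> - closure (\<Omega>s (I\<^sub>2 n)) \<and>
         (\<exists>(R::real) (r::real) (A\<^sub>2::complex \<Rightarrow> real).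
            0 < 2 * R \<and> ereal (2 * R) < set_distance norm (X n) (\<Omega>s (I\<^sub>2 n)) \<and>
            R < r \<and> ereal r < set_distance norm (X n) (\<Omega>s (I\<^sub>2 n)) - ereal R \<and>
            (\<forall>x \<in> X n + ball 0 R. 0 < A\<^sub>2 x) \<and>
            locally_bounded_on (X n) A\<^sub>2 \<and>
            (\<forall>z \<in> \<Omega>s (I\<^sub>2 n). \<forall>x \<in> X n + ball 0 R.
               (SUP \<zeta>\<in>{\<zeta>. cmod (\<zeta> - (z - x)) = r}. cmod (g n \<zeta>) * \<nu> (I\<^sub>2 n) z) \<le> A\<^sub>2 x))) \<and>
        (\<forall>K. compact K \<longrightarrow>
           (\<exists>A\<^sub>3>0. \<forall>x \<in> \<Omega>s n.
              (\<integral>\<^sup>+ y\<in>K. ennreal (cmod (g n (x - y)) * \<nu> n x / cmod (x - y)) \<partial>lborel)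
                \<le> ennreal A\<^sub>3)))"

definition condition_D_b ::
  "(nat \<Rightarrow> complex set) \<Rightarrow> (nat \<Rightarrow> complex \<Rightarrow> real) \<Rightarrow> (nat \<Rightarrow> complex \<Rightarrow> complex)
     \<Rightarrow> (nat \<Rightarrow> nat) \<Rightarrow> (nat \<Rightarrow> nat) \<Rightarrow> bool" where
  "condition_D_b \<Omega>s \<nu> g I\<^sub>1 I\<^sub>4 \<longleftrightarrow>
     (\<forall>n\<ge>1. I\<^sub>4 n > n \<and>
        (\<exists>A\<^sub>4>0. \<forall>(k, p) \<in> {(I\<^sub>4 n, n), (I\<^sub>1 (I\<^sub>4 n), I\<^sub>1 (I\<^sub>4 n))}. \<forall>x \<in> \<Omega>s p.
           (\<integral>\<^sup>+ y\<in>\<Omega>s (I\<^sub>4 n).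
              ennreal (cmod (g (I\<^sub>1 (I\<^sub>4 n)) (x - y)) * \<nu> p x / (cmod (x - y) * \<nu> k y)) \<partial>lborel)
             \<le> ennreal A\<^sub>4))"

definition condition_D_c ::
  "(nat \<Rightarrow> complex set) \<Rightarrow> (nat \<Rightarrow> nat) \<Rightarrow> (nat \<Rightarrow> nat) \<Rightarrow> (nat \<Rightarrow> complex set) \<Rightarrow> bool" where
  "condition_D_c \<Omega>s I\<^sub>1 I\<^sub>4 X \<longleftrightarrow>
     (\<forall>n\<ge>1. \<forall>M. closed M \<and> M \<subseteq> closure (\<Omega>s n) \<longrightarrow>
        (\<forall>N \<in> components (- M). N \<inter> - closure (\<Omega>s n) \<noteq> {} \<longrightarrow> N \<inter> X (I\<^sub>1 (I\<^sub>4 n)) \<noteq> {}))"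

definition condition_D ::
  "(nat \<Rightarrow> complex set) \<Rightarrow> (nat \<Rightarrow> complex \<Rightarrow> real) \<Rightarrow> (nat \<Rightarrow> complex \<Rightarrow> complex)
     \<Rightarrow> (nat \<Rightarrow> nat) \<Rightarrow> (nat \<Rightarrow> nat) \<Rightarrow> (nat \<Rightarrow> nat) \<Rightarrow> (nat \<Rightarrow> complex set) \<Rightarrow> bool" where
  "condition_D \<Omega>s \<nu> g I\<^sub>1 I\<^sub>2 I\<^sub>4 X \<longleftrightarrow>
     (\<forall>n\<ge>1. \<Omega>s n \<noteq> UNIV \<and> (\<forall>k>n. 0 < set_distance norm (\<Omega>s n) (frontier (\<Omega>s k)))) \<and>
     condition_D_a \<Omega>s \<nu> g I\<^sub>1 I\<^sub>2 X \<and>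
     condition_D_b \<Omega>s \<nu> g I\<^sub>1 I\<^sub>4 \<and>
     condition_D_c \<Omega>s I\<^sub>1 I\<^sub>4 X"

end

theory Submission
  imports Defs "HOL-Complex_Analysis.Complex_Analysis"
begin

text \<open>
  The theorem is an approximation theorem of Runge type with weights, followed by a Mittag-Leffler argument.

  For one step from \<open>n\<close> let \<open>q = I\<^sub>4 n\<close>, \<open>p = I\<^sub>1 q\<close>, \<open>l = I\<^sub>2 p\<close> and let \<open>f\<close> be holomorphic on \<open>\<Omega>s p\<close> with
  \<open>cmod f * \<nu> p\<close> bounded. Since \<open>g p 0 = 1\<close>, Cauchy's integral formula may be written with the kernel
  \<open>g p (x - y) / (x - y)\<close>, which condition (D) makes integrable against the weights. It is applied to the union of
  the squares of a fine grid that are near \<open>\<Omega>s n\<close>; the contour then lies in \<open>\<Omega>s q\<close> and has positive distance from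
  \<open>\<Omega>s n\<close>. The hypotheses bound area integrals of the kernel, and for holomorphic integrands area integrals
  dominate contour integrals along nearby edges (\<open>submean_square\<close>, \<open>edge_integral_le_area\<close>). As \<open>\<nu> q\<close> is
  negligible compared with \<open>\<nu> p\<close> outside of compact sets, all but finitely many edges contribute little, uniformly in
  the norm of \<open>\<Omega>s n\<close> (\<open>apx_restrict_holomorphic\<close>).

  The finitely many other edges give integrals of kernels with poles \<open>y\<close> off the closure of \<open>\<Omega>s n\<close>. For poles in the
  set \<open>X p\<close> the kernel belongs to the weighted space on \<open>\<Omega>s l\<close>. The kernels depend holomorphically on the pole in the
  norm of \<open>\<Omega>s n\<close>, so lying in the closure of that space is a property that propagates along connected components
  (\<open>apx_component\<close>), and every component of the complement of the closure of \<open>\<Omega>s n\<close> meets \<open>X p\<close>. Integrals along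
  segments inherit the property (\<open>apx_segment\<close>). Hence \<open>f\<close> can be approximated on \<open>\<Omega>s n\<close> by elements of the weighted
  space on \<open>\<Omega>s l\<close> (\<open>runge_step\<close>).

  By hypothesis \<open>l\<close> is at least the index \<open>I\<^sub>1 (I\<^sub>4 (n + 1))\<close> at which the step from \<open>n + 1\<close> starts. The steps can be
  iterated, and the limit of the approximants is in the projective limit space (\<open>mittag_leffler_density\<close>). The
  index \<open>m\<close> is at least \<open>I\<^sub>1 (I\<^sub>4 n)\<close>, where the iteration starts.
\<close>

section \<open>Area integrals and point values of holomorphic functions\<close>

lemma contour_integral_rectpath:
  assumes le: "Re a \<le> Re b" "Im a \<le> Im b"
    and f: "continuous_on (path_image (rectpath a b)) f"
  shows "contour_integral (rectpath a b) f =
      contour_integral (linepath a (Complex (Re b) (Im a))) f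
    + contour_integral (linepath (Complex (Re b) (Im a)) b) f
    - contour_integral (linepath (Complex (Re a) (Im b)) b) f
    - contour_integral (linepath a (Complex (Re a) (Im b))) f"
proof -
  define a2 a4 where "a2 = Complex (Re b) (Im a)" and "a4 = Complex (Re a) (Im b)"
  have im: "path_image (rectpath a b) = closed_segment a a2 \<union> closed_segment a2 b \<union>
      closed_segment b a4 \<union> closed_segment a4 a"
    by (simp add: rectpath_def Let_def path_image_join Un_assoc a2_def a4_def)
  have int: "f contour_integrable_on (linepath a a2)" "f contour_integrable_on (linepath a2 b)"
    "f contour_integrable_on (linepath b a4)" "f contour_integrable_on (linepath a4 a)"
    by (rule contour_integrable_continuous_linepath, rule continuous_on_subset[OF f], use im in blast)+
  have "contour_integral (rectpath a b) f =
      contour_integral (linepath a a2) f + (contour_integral (linepath a2 b) f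
    + (contour_integral (linepath b a4) f + contour_integral (linepath a4 a) f))"
    using int by (simp add: rectpath_def Let_def a2_def[symmetric] a4_def[symmetric])
  moreover have "contour_integral (linepath b a4) f = - contour_integral (linepath a4 b) f"
    "contour_integral (linepath a4 a) f = - contour_integral (linepath a a4) f"
    using contour_integral_reverse_linepath[of b a4 f] contour_integral_reverse_linepath[of a4 a f]
      continuous_on_subset[OF f] im by (force simp: closed_segment_commute)+
  ultimately show ?thesis by (simp add: a2_def a4_def)
qed

text \<open>
  Fubini is available for product measures, so planar Lebesgue measure is identified with the product
  of two linear ones by comparing the two measures on boxes.
\<close>
lemma lborel_complex_eq_distr:
  "(lborel :: complex measure) = distr (lborel \<Otimes>\<^sub>M lborel) borel (\<lambda>(s, t). Complex s t)"
proof (rule lborel_eqI)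
  have meas [measurable]: "(\<lambda>(s, t). Complex s t) \<in> borel_measurable (lborel \<Otimes>\<^sub>M lborel)"
    unfolding lborel_prod split_def by (simp add: borel_measurable_continuous_onI continuous_intros)
  fix l u :: complex
  assume le: "\<And>b. b \<in> Basis \<Longrightarrow> l \<bullet> b \<le> u \<bullet> b"
  then have "Re l \<le> Re u" "Im l \<le> Im u" using le[of 1] le[of \<i>] by (auto simp: Basis_complex_def)
  have "(\<lambda>(s, t). Complex s t) -` box l u \<inter> space (lborel \<Otimes>\<^sub>M lborel)
      = {Re l<..<Re u} \<times> {Im l<..<Im u}"
    by (auto simp: in_box_complex_iff space_pair_measure)
  then have "emeasure (distr (lborel \<Otimes>\<^sub>M lborel) borel (\<lambda>(s, t). Complex s t)) (box l u)
      = emeasure (lborel \<Otimes>\<^sub>M lborel) ({Re l<..<Re u} \<times> {Im l<..<Im u})"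
    by (simp add: emeasure_distr)
  also have "\<dots> = ennreal (Re u - Re l) * ennreal (Im u - Im l)"
    using \<open>Re l \<le> Re u\<close> \<open>Im l \<le> Im u\<close> by (simp add: lborel.emeasure_pair_measure_Times)
  also have "\<dots> = (\<Prod>b\<in>Basis. (u - l) \<bullet> b)"
    using \<open>Re l \<le> Re u\<close> \<open>Im l \<le> Im u\<close>
    by (simp add: Basis_complex_def ennreal_mult inner_complex_def)
  finally show "emeasure (distr (lborel \<Otimes>\<^sub>M lborel) borel (\<lambda>(s, t). Complex s t)) (box l u)
      = (\<Prod>b\<in>Basis. (u - l) \<bullet> b)" .
qed simp

lemma nn_integral_complex_iterated:
  assumes h: "h \<in> borel_measurable borel"
  shows "(\<integral>\<^sup>+z. h z \<partial>lborel) = (\<integral>\<^sup>+s. \<integral>\<^sup>+t. h (Complex s t) \<partial>lborel \<partial>lborel)" (is ?thesis1)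
    and "(\<integral>\<^sup>+z. h z \<partial>lborel) = (\<integral>\<^sup>+t. \<integral>\<^sup>+s. h (Complex s t) \<partial>lborel \<partial>lborel)" (is ?thesis2)
proof -
  have [measurable]: "(\<lambda>(s, t). Complex s t) \<in> borel_measurable (lborel \<Otimes>\<^sub>M lborel)"
    unfolding lborel_prod split_def by (simp add: borel_measurable_continuous_onI continuous_intros)
  note h[measurable]
  have *: "(\<integral>\<^sup>+z. h z \<partial>lborel) = (\<integral>\<^sup>+p. (case p of (s, t) \<Rightarrow> h (Complex s t)) \<partial>(lborel \<Otimes>\<^sub>M lborel))"
    by (subst lborel_complex_eq_distr, subst nn_integral_distr) (auto simp: split_def)
  have m: "(\<lambda>(s, t). h (Complex s t)) \<in> borel_measurable (lborel \<Otimes>\<^sub>M lborel)"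
    using measurable_compose[OF \<open>(\<lambda>(s, t). Complex s t) \<in> _\<close> h] by (simp add: split_def)
  show ?thesis1
    unfolding * using lborel.nn_integral_fst[OF m] by simp
  show ?thesis2
    unfolding * using lborel_pair.nn_integral_snd[OF m] by simp
qed

lemma contour_integral_linepath_same_Im:
  assumes "Im z = Im z'" "Re z < Re z'"
  shows "contour_integral (linepath z z') f = integral {Re z..Re z'} (\<lambda>s. f (Complex s (Im z)))"
proof -
  define a b c where "a = Re z" and "b = Re z'" and "c = Im z"
  have "a < b" using assms by (simp add: a_def b_def)
  have zz': "z = Complex a c" "z' = Complex b c"
    using assms by (auto simp: complex_eq_iff a_def b_def c_def)
  have "contour_integral (linepath z z') f = of_real (b - a) * integral {0..1} (\<lambda>x. f (linepath z z' x))"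
    by (simp add: contour_integral_integral zz' Complex_eq)
  also have "integral {0..1} (\<lambda>x. f (linepath z z' x)) =
      integral {0..(b - a) / (b - a)} (\<lambda>x. f (Complex (a + (b - a) * x) c))"
    using \<open>a < b\<close> by (simp add: linepath_def Complex_eq scaleR_conv_of_real algebra_simps zz')
  also have "{0..(b - a) / (b - a)} = (\<lambda>x. x / (b - a)) ` {0..b - a}"
    using \<open>a < b\<close> by simp
  also have "integral \<dots> (\<lambda>x. f (Complex (a + (b - a) * x) c)) =
      integral {a-a..b-a} (\<lambda>x. f (Complex (x + a) c)) / of_real (b - a)"
    using \<open>a < b\<close> by (subst integral_stretch_real) (auto simp: scaleR_conv_of_real add_ac)
  also have "\<dots> = integral {a..b} (\<lambda>x. f (Complex x c)) / of_real (b - a)"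
    by (subst integral_shift_real_ivl) (rule refl)
  finally show ?thesis
    using \<open>a < b\<close> by (simp add: a_def b_def c_def)
qed

lemma norm_side_integral_le:
  fixes G :: "complex \<Rightarrow> complex"
  assumes c: "continuous_on (closed_segment a b) G"
  shows "Re a = Re b \<Longrightarrow> Im a < Im b \<Longrightarrow>
      ennreal (cmod (contour_integral (linepath a b) G))
        \<le> (\<integral>\<^sup>+t. ennreal (cmod (G (Complex (Re a) t))) * indicator {Im a..Im b} t \<partial>lborel)"
    and "Im a = Im b \<Longrightarrow> Re a < Re b \<Longrightarrow>
      ennreal (cmod (contour_integral (linepath a b) G))
        \<le> (\<integral>\<^sup>+s. ennreal (cmod (G (Complex s (Im a)))) * indicator {Re a..Re b} s \<partial>lborel)"
proof -
  have gen: "ennreal (cmod (integral {u..v} h))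
      \<le> (\<integral>\<^sup>+t. ennreal (cmod (h t)) * indicator {u..v} t \<partial>lborel)"
    if h: "continuous_on {u..v} h" for u v and h :: "real \<Rightarrow> complex"
  proof -
    have c': "continuous_on {u..v} (\<lambda>t. cmod (h t))" by (intro continuous_intros h)
    have "(\<integral>\<^sup>+t\<in>{u..v}. ennreal (cmod (h t)) \<partial>lborel) = ennreal (integral {u..v} (\<lambda>t. cmod (h t)))"
    proof (rule set_nn_integral_lborel_eq_integral)
      show "set_borel_measurable borel {u..v} (\<lambda>t. cmod (h t))"
        by (rule set_measurable_continuous_on[OF _ c']) simp
      show "(\<integral>\<^sup>+t\<in>{u..v}. ennreal (cmod (h t)) \<partial>lborel) < \<infinity>"
      proof -
        obtain B where B: "\<And>t. t \<in> {u..v} \<Longrightarrow> cmod (h t) \<le> B"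
          using compact_imp_bounded[OF compact_continuous_image[OF h compact_Icc]]
          unfolding bounded_iff by blast
        have "(\<integral>\<^sup>+t\<in>{u..v}. ennreal (cmod (h t)) \<partial>lborel) \<le> (\<integral>\<^sup>+t\<in>{u..v}. ennreal B \<partial>lborel)"
          by (intro nn_integral_mono) (auto simp: indicator_def intro!: ennreal_leI B)
        also have "\<dots> < \<infinity>"
          by (simp add: nn_integral_cmult_indicator ennreal_mult_less_top emeasure_lborel_Icc_eq)
        finally show ?thesis .
      qed
    qed auto
    moreover have "cmod (integral {u..v} h) \<le> integral {u..v} (\<lambda>t. cmod (h t))"
      using c' h by (intro integral_norm_bound_integral integrable_continuous_real) auto
    ultimately show ?thesis by (simp add: ennreal_leI)
  qed
  show "ennreal (cmod (contour_integral (linepath a b) G))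
        \<le> (\<integral>\<^sup>+t. ennreal (cmod (G (Complex (Re a) t))) * indicator {Im a..Im b} t \<partial>lborel)"
    if "Re a = Re b" "Im a < Im b"
  proof -
    have "continuous_on {Im a..Im b} (\<lambda>t. G (Complex (Re a) t))"
      by (rule continuous_on_compose2[OF c])
         (use that in \<open>auto simp: closed_segment_same_Re closed_segment_eq_real_ivl intro!: continuous_intros\<close>)
    then have "ennreal (cmod (integral {Im a..Im b} (\<lambda>t. G (Complex (Re a) t))))
       \<le> (\<integral>\<^sup>+t. ennreal (cmod (G (Complex (Re a) t))) * indicator {Im a..Im b} t \<partial>lborel)"
      by (rule gen)
    moreover have "contour_integral (linepath a b) G
        = \<i> * integral {Im a..Im b} (\<lambda>t. G (Complex (Re a) t))"
      by (rule contour_integral_linepath_same_Re) (use that in auto)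
    ultimately show ?thesis by (simp add: norm_mult)
  qed
  show "ennreal (cmod (contour_integral (linepath a b) G))
        \<le> (\<integral>\<^sup>+s. ennreal (cmod (G (Complex s (Im a)))) * indicator {Re a..Re b} s \<partial>lborel)"
    if "Im a = Im b" "Re a < Re b"
  proof -
    have "continuous_on {Re a..Re b} (\<lambda>t. G (Complex t (Im a)))"
      by (rule continuous_on_compose2[OF c])
         (use that in \<open>auto simp: closed_segment_same_Im closed_segment_eq_real_ivl intro!: continuous_intros\<close>)
    then have "ennreal (cmod (integral {Re a..Re b} (\<lambda>t. G (Complex t (Im a)))))
       \<le> (\<integral>\<^sup>+t. ennreal (cmod (G (Complex t (Im a)))) * indicator {Re a..Re b} t \<partial>lborel)"
      by (rule gen)
    moreover have "contour_integral (linepath a b) G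
        = integral {Re a..Re b} (\<lambda>s. G (Complex s (Im a)))"
      by (rule contour_integral_linepath_same_Im) (use that in auto)
    ultimately show ?thesis by simp
  qed
qed

text \<open>
  An integral bound controls point values of a holomorphic function. For \<open>r / 2 \<le> p \<le> r\<close> Cauchy's
  formula on the boundary of the square with half side \<open>p\<close> bounds \<open>2 * pi * cmod (G c)\<close> by \<open>2 / r\<close>
  times the integral of \<open>cmod G\<close> over the four sides; integrating in \<open>p\<close> sweeps each side through part
  of the square. Squares instead of discs keep the argument within Fubini for Cartesian coordinates.
\<close>
lemma submean_square:
  fixes G :: "complex \<Rightarrow> complex"
  assumes r: "0 < r"
    and hol: "G holomorphic_on cbox (c - Complex r r) (c + Complex r r)"
  shows "ennreal (r\<^sup>2 * cmod (G c))
      \<le> 3 * (\<integral>\<^sup>+z\<in>cbox (c - Complex r r) (c + Complex r r). ennreal (cmod (G z)) \<partial>lborel)"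
proof -
  define Q where "Q = cbox (c - Complex r r) (c + Complex r r)"
  define h where "h z = ennreal (cmod (G z)) * indicator Q z" for z
  define I where "I = (\<integral>\<^sup>+z. h z \<partial>lborel)"
  have contG: "continuous_on Q G"
    using hol by (simp add: Q_def holomorphic_on_imp_continuous_on)
  have "(\<lambda>z. indicator Q z *\<^sub>R cmod (G z)) \<in> borel_measurable borel"
    by (intro borel_measurable_continuous_on_indicator continuous_intros contG) (auto simp: Q_def)
  then have "(\<lambda>z. ennreal (indicator Q z *\<^sub>R cmod (G z))) \<in> borel_measurable borel" by measurable
  also have "(\<lambda>z. ennreal (indicator Q z *\<^sub>R cmod (G z))) = h"
    by (auto simp: h_def indicator_def)
  finally have h [measurable]: "h \<in> borel_measurable borel" .
  have [measurable]: "(\<lambda>s. Complex s t) \<in> borel_measurable borel" "(\<lambda>s. Complex t s) \<in> borel_measurable borel" for t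
    by (intro borel_measurable_continuous_onI continuous_intros)+
  \<comment> \<open>\<open>V s\<close> and \<open>H t\<close> integrate \<open>cmod G\<close> along the vertical and horizontal chords of the square.\<close>
  define V where "V s = (\<integral>\<^sup>+t. h (Complex s t) \<partial>lborel)" for s
  define H where "H t = (\<integral>\<^sup>+s. h (Complex s t) \<partial>lborel)" for t
  have pairm: "(\<lambda>(s, t). h (Complex s t)) \<in> borel_measurable (borel \<Otimes>\<^sub>M lborel)"
    "(\<lambda>(t, s). h (Complex s t)) \<in> borel_measurable (borel \<Otimes>\<^sub>M lborel)"
  proof -
    have 1: "(\<lambda>p. Complex (fst p) (snd p)) \<in> borel_measurable (borel \<Otimes>\<^sub>M borel)"
      "(\<lambda>p. Complex (snd p) (fst p)) \<in> borel_measurable (borel \<Otimes>\<^sub>M borel)"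
      unfolding borel_prod by (auto intro!: borel_measurable_continuous_onI continuous_intros)
    show "(\<lambda>(s, t). h (Complex s t)) \<in> borel_measurable (borel \<Otimes>\<^sub>M lborel)"
     "(\<lambda>(t, s). h (Complex s t)) \<in> borel_measurable (borel \<Otimes>\<^sub>M lborel)"
      using measurable_compose[OF 1(1) h] measurable_compose[OF 1(2) h]
      by (simp_all add: split_def cong: measurable_cong_sets)
  qed
  have V [measurable]: "V \<in> borel_measurable borel" and H [measurable]: "H \<in> borel_measurable borel"
    unfolding V_def H_def
    using lborel.borel_measurable_nn_integral[OF pairm(1)] lborel.borel_measurable_nn_integral[OF pairm(2)]
    by simp_all
  have IV: "I = (\<integral>\<^sup>+s. V s \<partial>lborel)" and IH: "I = (\<integral>\<^sup>+t. H t \<partial>lborel)"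
    unfolding I_def V_def H_def by (rule nn_integral_complex_iterated[OF h])+
  have bound: "ennreal (pi * r * cmod (G c))
      \<le> V (Re c + p) + V (Re c - p) + H (Im c + p) + H (Im c - p)"
    if p: "r / 2 \<le> p" "p \<le> r" for p
  proof -
    have p0: "0 < p" using r p by simp
    define a b where "a = c - Complex p p" and "b = c + Complex p p"
    define K where "K w = G w / (w - c)" for w
    have im: "path_image (rectpath a b) = {z. Re z \<in> {Re a, Re b} \<and> Im z \<in> {Im a..Im b}} \<union>
           {z. Im z \<in> {Im a, Im b} \<and> Re z \<in> {Re a..Re b}}"
      by (rule path_image_rectpath) (use p0 in \<open>auto simp: a_def b_def\<close>)
    have imQ: "path_image (rectpath a b) \<subseteq> Q - {c}"
      unfolding im Q_def in_cbox_complex_iff subset_iff using p p0 by (auto simp: a_def b_def in_cbox_complex_iff)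
    have "(K has_contour_integral (2 * pi * \<i> * winding_number (rectpath a b) c * G c)) (rectpath a b)"
      unfolding K_def
    proof (rule Cauchy_integral_formula_convex_simple)
      show "convex Q" by (simp add: Q_def convex_box)
      show "c \<in> interior Q" using r by (simp add: Q_def interior_cbox in_box_complex_iff)
    qed (use hol imQ in \<open>auto simp: Q_def\<close>)
    moreover have "winding_number (rectpath a b) c = 1"
      by (rule winding_number_rectpath) (use p0 in \<open>simp add: a_def b_def in_box_complex_iff\<close>)
    ultimately have ci: "contour_integral (rectpath a b) K = 2 * pi * \<i> * G c"
      by (simp add: contour_integral_unique)
    have contK: "continuous_on (path_image (rectpath a b)) K"
      unfolding K_def using imQ by (intro continuous_intros continuous_on_subset[OF contG]) auto
    define a2 a4 where "a2 = Complex (Re b) (Im a)" and "a4 = Complex (Re a) (Im b)"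
    have split: "contour_integral (rectpath a b) K = contour_integral (linepath a a2) K
      + contour_integral (linepath a2 b) K - contour_integral (linepath a4 b) K
      - contour_integral (linepath a a4) K"
      unfolding a2_def a4_def
      by (rule contour_integral_rectpath[OF _ _ contK]) (use p0 in \<open>auto simp: a_def b_def\<close>)
    have Kle: "ennreal (cmod (K w)) \<le> ennreal (2 / r) * h w"
      if "w \<in> path_image (rectpath a b)" for w
    proof -
      have "p \<le> cmod (w - c)"
        using that abs_Re_le_cmod[of "w - c"] abs_Im_le_cmod[of "w - c"] p0
        unfolding im by (auto simp: a_def b_def)
      then have "cmod (K w) \<le> 2 / r * cmod (G w)"
        using p r frac_le[of "cmod (G w)" "cmod (G w)" "r / 2" "cmod (w - c)"]
        by (simp add: K_def norm_divide mult.commute)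
      then have le1: "ennreal (cmod (K w)) \<le> ennreal (2 / r * cmod (G w))" by (rule ennreal_leI)
      have "w \<in> Q" using that imQ by blast
      then have "ennreal (2 / r * cmod (G w)) = ennreal (2 / r) * h w"
        using r by (simp add: h_def flip: ennreal_mult)
      with le1 show ?thesis by simp
    qed
    have side: "closed_segment a a2 \<subseteq> path_image (rectpath a b)" "closed_segment a2 b \<subseteq> path_image (rectpath a b)"
      "closed_segment a4 b \<subseteq> path_image (rectpath a b)" "closed_segment a a4 \<subseteq> path_image (rectpath a b)"
      unfolding im using p0
      by (auto simp: a2_def a4_def a_def b_def closed_segment_same_Re closed_segment_same_Im closed_segment_eq_real_ivl)
    note cs = side[THEN continuous_on_subset[OF contK]]
    note corners = a_def b_def a2_def a4_def
    have n1: "ennreal (cmod (contour_integral (linepath a a2) K)) \<le> ennreal (2 / r) * H (Im c - p)"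
    proof -
      have "ennreal (cmod (contour_integral (linepath a a2) K))
        \<le> (\<integral>\<^sup>+s. ennreal (cmod (K (Complex s (Im a)))) * indicator {Re a..Re a2} s \<partial>lborel)"
        by (rule norm_side_integral_le(2)[OF cs(1)]) (use p0 in \<open>auto simp: corners\<close>)
      also have "\<dots> \<le> (\<integral>\<^sup>+s. ennreal (2 / r) * h (Complex s (Im c - p)) \<partial>lborel)"
      proof (rule nn_integral_mono)
        fix s show "ennreal (cmod (K (Complex s (Im a)))) * indicator {Re a..Re a2} s
          \<le> ennreal (2 / r) * h (Complex s (Im c - p))"
          using Kle[of "Complex s (Im a)"] im by (auto simp: indicator_def corners)
      qed
      also have "\<dots> = ennreal (2 / r) * H (Im c - p)"
        unfolding H_def by (rule nn_integral_cmult) measurable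
      finally show ?thesis .
    qed
    have n2: "ennreal (cmod (contour_integral (linepath a2 b) K)) \<le> ennreal (2 / r) * V (Re c + p)"
    proof -
      have "ennreal (cmod (contour_integral (linepath a2 b) K))
        \<le> (\<integral>\<^sup>+t. ennreal (cmod (K (Complex (Re a2) t))) * indicator {Im a2..Im b} t \<partial>lborel)"
        by (rule norm_side_integral_le(1)[OF cs(2)]) (use p0 in \<open>auto simp: corners\<close>)
      also have "\<dots> \<le> (\<integral>\<^sup>+t. ennreal (2 / r) * h (Complex (Re c + p) t) \<partial>lborel)"
      proof (rule nn_integral_mono)
        fix t show "ennreal (cmod (K (Complex (Re a2) t))) * indicator {Im a2..Im b} t
          \<le> ennreal (2 / r) * h (Complex (Re c + p) t)"
          using Kle[of "Complex (Re a2) t"] im by (auto simp: indicator_def corners)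
      qed
      also have "\<dots> = ennreal (2 / r) * V (Re c + p)"
        unfolding V_def by (rule nn_integral_cmult) measurable
      finally show ?thesis .
    qed
    have n3: "ennreal (cmod (contour_integral (linepath a4 b) K)) \<le> ennreal (2 / r) * H (Im c + p)"
    proof -
      have "ennreal (cmod (contour_integral (linepath a4 b) K))
        \<le> (\<integral>\<^sup>+s. ennreal (cmod (K (Complex s (Im a4)))) * indicator {Re a4..Re b} s \<partial>lborel)"
        by (rule norm_side_integral_le(2)[OF cs(3)]) (use p0 in \<open>auto simp: corners\<close>)
      also have "\<dots> \<le> (\<integral>\<^sup>+s. ennreal (2 / r) * h (Complex s (Im c + p)) \<partial>lborel)"
      proof (rule nn_integral_mono)
        fix s show "ennreal (cmod (K (Complex s (Im a4)))) * indicator {Re a4..Re b} s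
          \<le> ennreal (2 / r) * h (Complex s (Im c + p))"
          using Kle[of "Complex s (Im a4)"] im by (auto simp: indicator_def corners)
      qed
      also have "\<dots> = ennreal (2 / r) * H (Im c + p)"
        unfolding H_def by (rule nn_integral_cmult) measurable
      finally show ?thesis .
    qed
    have n4: "ennreal (cmod (contour_integral (linepath a a4) K)) \<le> ennreal (2 / r) * V (Re c - p)"
    proof -
      have "ennreal (cmod (contour_integral (linepath a a4) K))
        \<le> (\<integral>\<^sup>+t. ennreal (cmod (K (Complex (Re a) t))) * indicator {Im a..Im a4} t \<partial>lborel)"
        by (rule norm_side_integral_le(1)[OF cs(4)]) (use p0 in \<open>auto simp: corners\<close>)
      also have "\<dots> \<le> (\<integral>\<^sup>+t. ennreal (2 / r) * h (Complex (Re c - p) t) \<partial>lborel)"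
      proof (rule nn_integral_mono)
        fix t show "ennreal (cmod (K (Complex (Re a) t))) * indicator {Im a..Im a4} t
          \<le> ennreal (2 / r) * h (Complex (Re c - p) t)"
          using Kle[of "Complex (Re a) t"] im by (auto simp: indicator_def corners)
      qed
      also have "\<dots> = ennreal (2 / r) * V (Re c - p)"
        unfolding V_def by (rule nn_integral_cmult) measurable
      finally show ?thesis .
    qed
    have "2 * pi * cmod (G c) = cmod (contour_integral (rectpath a b) K)"
      by (simp add: ci norm_mult)
    also have "\<dots> \<le> cmod (contour_integral (linepath a a2) K) + cmod (contour_integral (linepath a2 b) K)
       + cmod (contour_integral (linepath a4 b) K) + cmod (contour_integral (linepath a a4) K)"
      unfolding split by (intro norm_triangle_le_diff add_mono norm_triangle_ineq order_refl)
    finally have "ennreal (2 * pi * cmod (G c)) \<le> ennreal (cmod (contour_integral (linepath a a2) K))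
       + ennreal (cmod (contour_integral (linepath a2 b) K))
       + ennreal (cmod (contour_integral (linepath a4 b) K)) + ennreal (cmod (contour_integral (linepath a a4) K))"
      by (simp flip: ennreal_plus)
    also have "\<dots> \<le> ennreal (2 / r) * H (Im c - p) + ennreal (2 / r) * V (Re c + p)
       + ennreal (2 / r) * H (Im c + p) + ennreal (2 / r) * V (Re c - p)"
      by (intro add_mono n1 n2 n3 n4)
    also have "\<dots> = ennreal (2 / r) * (V (Re c + p) + V (Re c - p) + H (Im c + p) + H (Im c - p))"
      by (simp add: distrib_left add_ac)
    finally have "ennreal (r / 2) * ennreal (2 * pi * cmod (G c)) \<le> ennreal (r / 2) *
      (ennreal (2 / r) * (V (Re c + p) + V (Re c - p) + H (Im c + p) + H (Im c - p)))"
      by (rule mult_left_mono) simp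
    also have "ennreal (r / 2) * ennreal (2 * pi * cmod (G c)) = ennreal (pi * r * cmod (G c))"
      using r by (subst ennreal_mult[symmetric]) auto
    also have "ennreal (r / 2) *
      (ennreal (2 / r) * (V (Re c + p) + V (Re c - p) + H (Im c + p) + H (Im c - p)))
      = V (Re c + p) + V (Re c - p) + H (Im c + p) + H (Im c - p)"
    proof -
      have "ennreal (r / 2) * ennreal (2 / r) = 1"
        using r by (subst ennreal_mult[symmetric]) auto
      then show ?thesis by (simp only: mult.assoc[symmetric] mult_1)
    qed
    finally show ?thesis .
  qed
  have four: "J + J + J + J = 4 * J" for J :: ennreal
  proof -
    have "(4 :: ennreal) = 1 + 1 + 1 + 1" by simp
    then show ?thesis by (simp only: distrib_right mult_1)
  qed
  have shift: "(\<integral>\<^sup>+p. F (x + p) \<partial>lborel) = (\<integral>\<^sup>+p. F p \<partial>lborel)"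
    "(\<integral>\<^sup>+p. F (x - p) \<partial>lborel) = (\<integral>\<^sup>+p. F p \<partial>lborel)"
    if [measurable]: "F \<in> borel_measurable borel" for F :: "real \<Rightarrow> ennreal" and x
    using nn_integral_real_affine[OF that, of 1 x] nn_integral_real_affine[OF that, of "-1" x]
    by (simp_all add: one_ennreal_def[symmetric])
  have "ennreal (pi * r * cmod (G c)) * ennreal (r / 2)
    = (\<integral>\<^sup>+p. ennreal (pi * r * cmod (G c)) * indicator {r/2..r} p \<partial>lborel)"
    using r by (simp add: nn_integral_cmult_indicator)
  also have "\<dots> \<le> (\<integral>\<^sup>+p. V (Re c + p) + V (Re c - p) + H (Im c + p) + H (Im c - p) \<partial>lborel)"
    by (intro nn_integral_mono) (use bound in \<open>auto simp: indicator_def\<close>)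
  also have "\<dots> = 4 * I"
    by (simp add: nn_integral_add shift four flip: IV IH)
  finally have le: "ennreal (pi * r * cmod (G c)) * ennreal (r / 2) \<le> 4 * I" .
  have "ennreal (4 / 3) * ennreal (r\<^sup>2 * cmod (G c)) \<le> ennreal (pi * r * cmod (G c)) * ennreal (r / 2)"
  proof -
    \<comment> \<open>The factor 3 in the claim is \<open>4\<close> divided by this lower bound for \<open>pi / 2\<close>.\<close>
    have "4 / 3 \<le> pi / 2" using pi_gt3 by simp
    then have "4 / 3 * (r\<^sup>2 * cmod (G c)) \<le> pi / 2 * (r\<^sup>2 * cmod (G c))"
      by (rule mult_right_mono) simp
    also have "pi / 2 * (r\<^sup>2 * cmod (G c)) = pi * r * cmod (G c) * (r / 2)"
      by (simp add: power2_eq_square)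
    finally have "ennreal (4 / 3 * (r\<^sup>2 * cmod (G c))) \<le> ennreal (pi * r * cmod (G c) * (r / 2))"
      by (rule ennreal_leI)
    then show ?thesis
      using r by (subst (1 2) ennreal_mult[symmetric]) auto
  qed
  also note le
  finally have "ennreal (3 / 4) * (ennreal (4 / 3) * ennreal (r\<^sup>2 * cmod (G c))) \<le> ennreal (3 / 4) * (4 * I)"
    by (rule mult_left_mono) simp
  also have "ennreal (3 / 4) * (4 * I) = 3 * I"
  proof -
    have "ennreal (3 / 4) * ennreal 4 = ennreal 3"
      by (subst ennreal_mult[symmetric]) auto
    then have "ennreal (3 / 4) * 4 = 3" by simp
    then show ?thesis by (simp only: mult.assoc[symmetric])
  qed
  also have "ennreal (3 / 4) * (ennreal (4 / 3) * ennreal (r\<^sup>2 * cmod (G c))) = ennreal (r\<^sup>2 * cmod (G c))"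
  proof -
    have "ennreal (3 / 4) * ennreal (4 / 3) = 1"
      by (subst ennreal_mult[symmetric]) auto
    then show ?thesis by (simp only: mult.assoc[symmetric] mult_1)
  qed
  finally have "ennreal (r\<^sup>2 * cmod (G c)) \<le> 3 * I" .
  then show ?thesis
    by (simp add: I_def h_def Q_def)
qed

section \<open>Closures in weighted supremum norms and pole pushing\<close>

definition approx_in where
  "approx_in H S w u \<longleftrightarrow> (\<forall>\<epsilon>>0. \<exists>a\<in>H. \<forall>x\<in>S. cmod (u x - a x) * w x \<le> \<epsilon>)"
  for H :: "(complex \<Rightarrow> complex) set" and w :: "complex \<Rightarrow> real"

text \<open>
  \<open>H\<close> is a complex vector space of functions, and the predicate \<open>apx\<close> below describes its closure with
  respect to the supremum over \<open>S\<close> weighted with \<open>w\<close>.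
\<close>
locale weighted_closure =
  fixes H :: "(complex \<Rightarrow> complex) set" and S :: "complex set" and w :: "complex \<Rightarrow> real"
  assumes zero_mem: "(\<lambda>x. 0) \<in> H"
    and add_mem: "a \<in> H \<Longrightarrow> b \<in> H \<Longrightarrow> (\<lambda>x. a x + b x) \<in> H"
    and scale_mem: "a \<in> H \<Longrightarrow> (\<lambda>x. c * a x) \<in> H"
    and weight_nonneg: "x \<in> S \<Longrightarrow> 0 \<le> w x"
begin

abbreviation "apx \<equiv> approx_in H S w"

lemma apx_mem: "a \<in> H \<Longrightarrow> apx a"
  unfolding approx_in_def by (intro allI impI bexI[of _ a]) auto

lemma apx_cong: "apx u \<Longrightarrow> (\<And>x. x \<in> S \<Longrightarrow> u x = v x) \<Longrightarrow> apx v"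
  unfolding approx_in_def by simp

lemma apx_add:
  assumes "apx u" "apx v" shows "apx (\<lambda>x. u x + v x)"
  unfolding approx_in_def
proof (intro allI impI)
  fix \<epsilon> :: real assume "\<epsilon> > 0"
  then have "\<epsilon> / 2 > 0" by simp
  then obtain a b where ab: "a \<in> H" "b \<in> H"
    "\<And>x. x \<in> S \<Longrightarrow> cmod (u x - a x) * w x \<le> \<epsilon> / 2" "\<And>x. x \<in> S \<Longrightarrow> cmod (v x - b x) * w x \<le> \<epsilon> / 2"
    using assms unfolding approx_in_def by metis
  show "\<exists>a\<in>H. \<forall>x\<in>S. cmod (u x + v x - a x) * w x \<le> \<epsilon>"
  proof (intro bexI[of _ "\<lambda>x. a x + b x"] ballI)
    fix x assume x: "x \<in> S"
    have "cmod (u x + v x - (a x + b x)) \<le> cmod (u x - a x) + cmod (v x - b x)"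
      by (rule norm_diff_triangle_ineq)
    then have "cmod (u x + v x - (a x + b x)) * w x \<le> (cmod (u x - a x) + cmod (v x - b x)) * w x"
      by (rule mult_right_mono) (rule weight_nonneg[OF x])
    then show "cmod (u x + v x - (a x + b x)) * w x \<le> \<epsilon>"
      using ab(3,4)[OF x] by (simp add: distrib_right)
  qed (use ab add_mem in auto)
qed

lemma apx_scale:
  assumes "apx u" shows "apx (\<lambda>x. c * u x)"
  unfolding approx_in_def
proof (intro allI impI)
  fix \<epsilon> :: real assume "\<epsilon> > 0"
  then have "\<epsilon> / (cmod c + 1) > 0" by (simp add: add_nonneg_pos)
  then obtain a where a: "a \<in> H" "\<And>x. x \<in> S \<Longrightarrow> cmod (u x - a x) * w x \<le> \<epsilon> / (cmod c + 1)"
    using assms unfolding approx_in_def by metis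
  show "\<exists>a\<in>H. \<forall>x\<in>S. cmod (c * u x - a x) * w x \<le> \<epsilon>"
  proof (intro bexI[of _ "\<lambda>x. c * a x"] ballI)
    fix x assume x: "x \<in> S"
    have "cmod (c * u x - c * a x) * w x = cmod c * (cmod (u x - a x) * w x)"
      by (simp flip: right_diff_distrib add: norm_mult)
    also have "\<dots> \<le> (cmod c + 1) * (\<epsilon> / (cmod c + 1))"
      by (rule mult_mono) (use a(2)[OF x] weight_nonneg[OF x] in auto)
    also have "\<dots> = \<epsilon>"
      using norm_ge_zero[of c] by (simp add: add_nonneg_eq_0_iff)
    finally show "cmod (c * u x - c * a x) * w x \<le> \<epsilon>" .
  qed (use a scale_mem in auto)
qed

lemma apx_sum: "finite I \<Longrightarrow> (\<And>i. i \<in> I \<Longrightarrow> apx (u i)) \<Longrightarrow> apx (\<lambda>x. \<Sum>i\<in>I. u i x)"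
  by (induction I rule: finite_induct) (auto intro: apx_mem zero_mem apx_add)

lemma apx_limit:
  assumes "\<And>\<epsilon>. \<epsilon> > 0 \<Longrightarrow> \<exists>v. apx v \<and> (\<forall>x\<in>S. cmod (u x - v x) * w x \<le> \<epsilon>)"
  shows "apx u"
  unfolding approx_in_def
proof (intro allI impI)
  fix \<epsilon> :: real assume "\<epsilon> > 0"
  then have e: "\<epsilon> / 2 > 0" by simp
  obtain v where v: "apx v" "\<And>x. x \<in> S \<Longrightarrow> cmod (u x - v x) * w x \<le> \<epsilon> / 2"
    using assms[OF e] by blast
  obtain a where a: "a \<in> H" "\<And>x. x \<in> S \<Longrightarrow> cmod (v x - a x) * w x \<le> \<epsilon> / 2"
    using v(1) e unfolding approx_in_def by blast
  show "\<exists>a\<in>H. \<forall>x\<in>S. cmod (u x - a x) * w x \<le> \<epsilon>"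
  proof (intro bexI[of _ a] ballI)
    fix x assume x: "x \<in> S"
    have "cmod (u x - a x) \<le> cmod (u x - v x) + cmod (v x - a x)"
      using norm_triangle_ineq[of "u x - v x" "v x - a x"] by simp
    then have "cmod (u x - a x) * w x \<le> (cmod (u x - v x) + cmod (v x - a x)) * w x"
      by (rule mult_right_mono) (rule weight_nonneg[OF x])
    then show "cmod (u x - a x) * w x \<le> \<epsilon>"
      using a(2)[OF x] v(2)[OF x] by (simp add: distrib_right)
  qed (rule a(1))
qed

lemma taylor_coeff_bound:
  assumes "E holomorphic_on U" "cball y1 \<rho> \<subseteq> U" "0 < \<rho>" "0 \<le> v"
    and "\<And>y. y \<in> cball y1 \<rho> \<Longrightarrow> cmod (E y) * v \<le> M"
  shows "cmod ((deriv ^^ k) E y1 / fact k) * v \<le> M / \<rho> ^ k"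
proof -
  have hol: "E holomorphic_on cball y1 \<rho>" using assms holomorphic_on_subset by blast
  have "(\<lambda>y. of_real v * E y) holomorphic_on ball y1 \<rho>"
    by (intro holomorphic_intros holomorphic_on_subset[OF hol]) auto
  moreover have "continuous_on (cball y1 \<rho>) (\<lambda>y. of_real v * E y)"
    by (intro continuous_intros holomorphic_on_imp_continuous_on[OF hol])
  moreover have "cmod (of_real v * E y) \<le> M" if "norm (y1 - y) = \<rho>" for y
    using assms(4) assms(5)[of y] that by (simp add: norm_mult dist_norm mult.commute)
  ultimately have "cmod ((deriv ^^ k) (\<lambda>y. of_real v * E y) y1) \<le> fact k * M / \<rho> ^ k"
    using assms(3) by (rule_tac Cauchy_inequality) auto
  also have "(deriv ^^ k) (\<lambda>y. of_real v * E y) y1 = of_real v * (deriv ^^ k) E y1"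
    by (rule higher_deriv_cmult[OF holomorphic_on_subset[OF hol ball_subset_cball]])
       (use assms(3) in auto)
  finally show ?thesis
    using assms(4) by (simp add: norm_mult norm_divide field_simps)
qed

text \<open>
  The functions \<open>E y\<close> form a holomorphic family in the parameter \<open>y\<close>. A bound in the weighted norm on a
  disc makes the Taylor series in \<open>y\<close> converge geometrically in that norm, uniformly in \<open>x\<close>; this replaces
  the theory of Banach space valued holomorphic functions.
\<close>
lemma taylor_tail_bound:
  assumes hol: "\<And>x. x \<in> S \<Longrightarrow> (\<lambda>y. E y x) holomorphic_on U"
    and \<rho>: "cball y1 \<rho> \<subseteq> U" "0 < \<rho>"
    and M: "\<And>x y. x \<in> S \<Longrightarrow> y \<in> cball y1 \<rho> \<Longrightarrow> cmod (E y x) * w x \<le> M"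
    and x: "x \<in> S" and y: "cmod (y - y1) \<le> t" "t < \<rho>"
  shows "cmod (E y x - (\<Sum>k<N. (y - y1) ^ k * ((deriv ^^ k) (\<lambda>y. E y x) y1 / fact k))) * w x
    \<le> M * (t / \<rho>) ^ N / (1 - t / \<rho>)"
proof -
  have t: "0 \<le> t" using y(1) norm_ge_zero order_trans by blast
  have q: "0 \<le> t / \<rho>" "t / \<rho> < 1" using t y \<rho> by auto
  define c where "c k = (deriv ^^ k) (\<lambda>y. E y x) y1 / fact k" for k
  have bnd: "cmod ((y - y1) ^ k * c k * of_real (w x)) \<le> M * (t / \<rho>) ^ k" for k
  proof -
    have "cmod (c k) * w x \<le> M / \<rho> ^ k"
      unfolding c_def by (rule taylor_coeff_bound[OF hol[OF x] \<rho> weight_nonneg[OF x]]) (rule M[OF x])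
    then have "cmod (y - y1) ^ k * (cmod (c k) * w x) \<le> t ^ k * (M / \<rho> ^ k)"
      using y(1) weight_nonneg[OF x] t by (intro mult_mono power_mono) auto
    then show ?thesis
      using weight_nonneg[OF x] by (simp add: norm_mult norm_power power_divide mult_ac)
  qed
  have "(\<lambda>k. c k * (y - y1) ^ k) sums E y x"
    unfolding c_def
  proof (rule holomorphic_power_series[where r = \<rho>])
    show "(\<lambda>y. E y x) holomorphic_on ball y1 \<rho>"
      using holomorphic_on_subset[OF hol[OF x]] \<rho>(1) ball_subset_cball by blast
  qed (use y in \<open>auto simp: dist_norm norm_minus_commute\<close>)
  then have s: "(\<lambda>k. (y - y1) ^ (k + N) * c (k + N) * w x) sums ((E y x - (\<Sum>k<N. (y - y1) ^ k * c k)) * w x)"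
    by (intro sums_mult2 sums_split_initial_segment) (simp add: mult.commute)
  have g: "(\<lambda>k. M * (t / \<rho>) ^ (k + N)) sums (M * (t / \<rho>) ^ N / (1 - t / \<rho>))"
    using sums_mult[OF geometric_sums[of "t / \<rho>"], of "M * (t / \<rho>) ^ N"] q
    by (simp add: power_add mult_ac)
  have "cmod ((E y x - (\<Sum>k<N. (y - y1) ^ k * c k)) * w x) \<le> M * (t / \<rho>) ^ N / (1 - t / \<rho>)"
    using norm_suminf_le[OF bnd sums_summable[OF g]] sums_unique[OF s] sums_unique[OF g] by simp
  then show ?thesis
    using weight_nonneg[OF x] by (simp add: norm_mult c_def)
qed

text \<open>
  If all \<open>E y\<close> with \<open>y\<close> near \<open>y1\<close> are in the closure, then so are the Taylor coefficients at \<open>y1\<close>: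
  the coefficient of order \<open>k\<close> is the limit for \<open>h \<rightarrow> 0\<close> of the difference between \<open>E (y1 + h)\<close> and its Taylor
  polynomial of degree \<open>k - 1\<close>, divided by \<open>h ^ k\<close>.
\<close>
lemma apx_taylor_coeff:
  assumes hol: "\<And>x. x \<in> S \<Longrightarrow> (\<lambda>y. E y x) holomorphic_on U"
    and \<rho>: "cball y1 \<rho> \<subseteq> U" "0 < \<rho>"
    and M: "\<And>x y. x \<in> S \<Longrightarrow> y \<in> cball y1 \<rho> \<Longrightarrow> cmod (E y x) * w x \<le> M"
    and r: "0 < r" "\<And>y. y \<in> ball y1 r \<Longrightarrow> apx (E y)"
  shows "apx (\<lambda>x. (deriv ^^ k) (\<lambda>y. E y x) y1 / fact k)"
proof (induction k rule: less_induct)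
  case (less k)
  define c where "c k x = (deriv ^^ k) (\<lambda>y. E y x) y1 / fact k" for k x
  show ?case
  proof (rule apx_limit)
    fix \<epsilon> :: real assume e: "\<epsilon> > 0"
    define M' where "M' = max M 1"
    have M': "M \<le> M'" "0 < M'" by (auto simp: M'_def)
    \<comment> \<open>With this \<open>h\<close> the ratio \<open>h / \<rho>\<close> is at most \<open>1 / 2\<close>, and the Taylor remainder divided by
      \<open>h ^ k\<close>, which is at most \<open>2 * M' * h / \<rho> ^ Suc k\<close>, is at most \<open>\<epsilon>\<close>.\<close>
    define h where "h = Min {r / 2, \<rho> / 2, \<epsilon> * \<rho> ^ Suc k / (2 * M')}"
    have h: "0 < h" "h < r" "h \<le> \<rho> / 2" "h \<le> \<epsilon> * \<rho> ^ Suc k / (2 * M')"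
      using r(1) \<rho>(2) e M' by (auto simp: h_def min_less_iff_disj)
    define v where "v x = 1 / of_real h ^ k * (E (y1 + h) x + (- 1) * (\<Sum>j<k. of_real h ^ j * c j x))" for x
    have "apx v"
      unfolding v_def c_def using h r(2)[of "y1 + h"]
      by (intro apx_scale apx_add apx_sum less) (auto simp: dist_norm)
    moreover have "cmod (c k x - v x) * w x \<le> \<epsilon>" if x: "x \<in> S" for x
    proof -
      have "cmod (E (y1 + h) x - (\<Sum>j<Suc k. (y1 + h - y1) ^ j * c j x)) * w x
          \<le> M' * (h / \<rho>) ^ Suc k / (1 - h / \<rho>)"
        unfolding c_def
        by (rule taylor_tail_bound[OF hol \<rho> _ x, where t = h])
           (use h \<rho> M M' in \<open>auto intro: order_trans\<close>)
      also have "\<dots> \<le> M' * (h / \<rho>) ^ Suc k / (1 / 2)"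
        using h \<rho> M' by (intro divide_left_mono mult_nonneg_nonneg) (auto simp: field_simps)
      also have "\<dots> = h ^ k * (h * (2 * M' / \<rho> ^ Suc k))"
        by (simp add: power_divide)
      also have "\<dots> \<le> h ^ k * \<epsilon>"
      proof (rule mult_left_mono)
        have "h * (2 * M' / \<rho> ^ Suc k) \<le> \<epsilon> * \<rho> ^ Suc k / (2 * M') * (2 * M' / \<rho> ^ Suc k)"
          using h M' \<rho> by (intro mult_right_mono) auto
        then show "h * (2 * M' / \<rho> ^ Suc k) \<le> \<epsilon>" using M' \<rho> by simp
      qed (use h in auto)
      finally have *: "cmod (E (y1 + h) x - (\<Sum>j<Suc k. of_real h ^ j * c j x)) * w x \<le> h ^ k * \<epsilon>"
        by simp
      have "v x - c k x = (E (y1 + h) x - (\<Sum>j<Suc k. of_real h ^ j * c j x)) / of_real h ^ k"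
        using h by (simp add: v_def field_simps)
      then have "cmod (c k x - v x) = cmod (E (y1 + h) x - (\<Sum>j<Suc k. of_real h ^ j * c j x)) / h ^ k"
        using h by (simp add: norm_minus_commute[of "c k x"] norm_divide norm_power)
      then show ?thesis using * h by (simp add: divide_le_eq mult.commute)
    qed
    ultimately show "\<exists>v. apx v \<and> (\<forall>x\<in>S. cmod ((deriv ^^ k) (\<lambda>y. E y x) y1 / fact k - v x) * w x \<le> \<epsilon>)"
      unfolding c_def by blast
  qed
qed

lemma geometric_small:
  fixes q B :: real
  assumes "0 \<le> q" "q < 1" "0 < \<epsilon>"
  obtains N where "B * q ^ N \<le> \<epsilon>"
proof -
  have "(\<lambda>N. B * q ^ N) \<longlonglongrightarrow> B * 0"
    using assms by (intro tendsto_mult_left LIMSEQ_realpow_zero) auto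
  then have "eventually (\<lambda>N. B * q ^ N < \<epsilon>) sequentially"
    using assms by (intro order_tendstoD) auto
  then show thesis using that by (auto simp: eventually_sequentially intro: less_imp_le)
qed

text \<open>
  Membership in the closure spreads from a neighbourhood of \<open>y1\<close> to the whole disc on which the family is
  bounded, since the Taylor polynomials belong to the closure and converge there.
\<close>
lemma apx_ball:
  assumes hol: "\<And>x. x \<in> S \<Longrightarrow> (\<lambda>y. E y x) holomorphic_on U"
    and \<rho>: "cball y1 \<rho> \<subseteq> U" "0 < \<rho>"
    and M: "\<And>x y. x \<in> S \<Longrightarrow> y \<in> cball y1 \<rho> \<Longrightarrow> cmod (E y x) * w x \<le> M"
    and r: "0 < r" "\<And>y. y \<in> ball y1 r \<Longrightarrow> apx (E y)"
    and y: "y \<in> ball y1 \<rho>"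
  shows "apx (E y)"
proof (rule apx_limit)
  fix \<epsilon> :: real assume e: "\<epsilon> > 0"
  define t where "t = cmod (y - y1)"
  have t: "0 \<le> t" "t < \<rho>" using y by (auto simp: t_def dist_norm norm_minus_commute)
  obtain N where N: "M / (1 - t / \<rho>) * (t / \<rho>) ^ N \<le> \<epsilon>"
    by (rule geometric_small[of "t / \<rho>" \<epsilon> "M / (1 - t / \<rho>)"]) (use t \<rho> e in auto)
  show "\<exists>v. apx v \<and> (\<forall>x\<in>S. cmod (E y x - v x) * w x \<le> \<epsilon>)"
  proof (intro exI conjI ballI)
    show "apx (\<lambda>x. \<Sum>k<N. (y - y1) ^ k * ((deriv ^^ k) (\<lambda>y. E y x) y1 / fact k))"
      by (intro apx_sum apx_scale apx_taylor_coeff[OF hol \<rho> M r]) auto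
    fix x assume x: "x \<in> S"
    show "cmod (E y x - (\<Sum>k<N. (y - y1) ^ k * ((deriv ^^ k) (\<lambda>y. E y x) y1 / fact k))) * w x \<le> \<epsilon>"
      using taylor_tail_bound[OF hol \<rho> M x, of y t N] t N by (simp add: t_def)
  qed
qed

text \<open>
  Pole pushing as an identity theorem: the set of parameters that have a neighbourhood of parameters in the
  closure is open, and it is closed in the component because the discs of the previous lemma reach every limit point.
\<close>
lemma apx_component:
  assumes U: "open U"
    and hol: "\<And>x. x \<in> S \<Longrightarrow> (\<lambda>y. E y x) holomorphic_on U"
    and bdd: "\<And>y. y \<in> U \<Longrightarrow> \<exists>\<rho>>0. \<exists>M. cball y \<rho> \<subseteq> U \<and>
        (\<forall>z\<in>cball y \<rho>. \<forall>x\<in>S. cmod (E z x) * w x \<le> M)"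
    and N: "N \<in> components U"
    and V: "open V" "V \<inter> N \<noteq> {}" "\<And>y. y \<in> V \<Longrightarrow> apx (E y)"
    and y: "y \<in> N"
  shows "apx (E y)"
proof -
  define T where "T = N \<inter> interior {y. apx (E y)}"
  have openN: "open N" using U N by (rule open_components)
  have NU: "N \<subseteq> U" using N by (rule in_components_subset)
  have "open T" using openN by (auto simp: T_def)
  moreover have "open (N - T)"
    unfolding open_contains_ball
  proof
    fix y assume y: "y \<in> N - T"
    obtain \<rho> M where \<rho>: "0 < \<rho>" "cball y \<rho> \<subseteq> U"
        "\<And>z x. z \<in> cball y \<rho> \<Longrightarrow> x \<in> S \<Longrightarrow> cmod (E z x) * w x \<le> M"
      using bdd[of y] y NU by blast
    obtain e where e: "e > 0" "ball y e \<subseteq> N" using openN y by (meson DiffD1 open_contains_ball)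
    have "z \<notin> T" if z: "z \<in> ball y (\<rho> / 2)" for z
    proof
      assume "z \<in> T"
      then have "z \<in> interior {y. apx (E y)}" by (simp add: T_def)
      then obtain r where r: "r > 0" "ball z r \<subseteq> {y. apx (E y)}"
        unfolding mem_interior by blast
      have sub: "cball z (\<rho> / 2) \<subseteq> cball y \<rho>"
      proof
        fix u assume "u \<in> cball z (\<rho> / 2)"
        then show "u \<in> cball y \<rho>" using z dist_triangle[of y u z] by simp
      qed
      have "ball z (\<rho> / 2) \<subseteq> {y. apx (E y)}"
      proof
        fix u assume u: "u \<in> ball z (\<rho> / 2)"
        have "apx (E u)"
        proof (rule apx_ball[OF hol])
          show "cball z (\<rho> / 2) \<subseteq> U" using sub \<rho>(2) by blast
          show "cmod (E y x) * w x \<le> M" if "x \<in> S" "y \<in> cball z (\<rho> / 2)" for x y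
            using \<rho>(3) sub that by blast
          show "apx (E y)" if "y \<in> ball z r" for y using r(2) that by blast
        qed (use \<rho>(1) r(1) u in auto)
        then show "u \<in> {y. apx (E y)}" by simp
      qed
      then have "ball z (\<rho> / 2) \<subseteq> interior {y. apx (E y)}"
        by (rule interior_maximal) simp
      moreover have "y \<in> ball z (\<rho> / 2)" using z by (simp add: dist_commute)
      ultimately show False using y by (auto simp: T_def)
    qed
    then have "ball y (min e (\<rho> / 2)) \<subseteq> N - T" using e by auto
    then show "\<exists>e>0. ball y e \<subseteq> N - T" using e \<rho> by (intro exI[of _ "min e (\<rho> / 2)"]) auto
  qed
  moreover have "connected N" using N by (rule in_components_connected)
  moreover have "V \<inter> N \<subseteq> T"
    using interior_maximal[of V "{y. apx (E y)}"] V by (auto simp: T_def)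
  ultimately have "N - T = {}"
    using V(2) connectedD[of N T "N - T"] by (auto simp: T_def)
  then show ?thesis using y interior_subset by (auto simp: T_def)
qed

text \<open>
  On a short segment the Taylor expansion about \<open>y1\<close> can be integrated term by term, which expresses the
  integral through the Taylor coefficients.
\<close>
lemma apx_segment_local:
  assumes hol: "\<And>x. x \<in> S \<Longrightarrow> (\<lambda>y. E y x) holomorphic_on U"
    and \<rho>: "cball y1 \<rho> \<subseteq> U" "0 < \<rho>"
    and M: "\<And>x y. x \<in> S \<Longrightarrow> y \<in> cball y1 \<rho> \<Longrightarrow> cmod (E y x) * w x \<le> M"
    and r: "0 < r" "\<And>y. y \<in> ball y1 r \<Longrightarrow> apx (E y)"
    and seg: "closed_segment a b \<subseteq> cball y1 (\<rho> / 2)"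
    and f: "continuous_on (closed_segment a b) f"
  shows "apx (\<lambda>x. contour_integral (linepath a b) (\<lambda>y. f y * E y x))"
proof (rule apx_limit)
  fix \<epsilon> :: real assume e: "\<epsilon> > 0"
  define M' where "M' = max M 0"
  obtain B where B: "\<And>y. y \<in> closed_segment a b \<Longrightarrow> cmod (f y) \<le> B" "0 \<le> B"
  proof -
    obtain B where "\<And>y. y \<in> closed_segment a b \<Longrightarrow> cmod (f y) \<le> B"
      using compact_imp_bounded[OF compact_continuous_image[OF f compact_segment]]
      unfolding bounded_iff by blast
    moreover from this[of a] have "0 \<le> B" using norm_ge_zero order_trans by (metis ends_in_segment(1))
    ultimately show thesis using that by blast
  qed
  obtain N where N: "B * (M' * 2) * cmod (b - a) * (1 / 2) ^ N \<le> \<epsilon>"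
    by (rule geometric_small[of "1 / 2" \<epsilon> "B * (M' * 2) * cmod (b - a)"]) (use e in auto)
  define c where "c k x = (deriv ^^ k) (\<lambda>y. E y x) y1 / fact k" for k x
  define v where "v x = (\<Sum>k<N. contour_integral (linepath a b) (\<lambda>y. f y * (y - y1) ^ k) * c k x)" for x
  have "apx v"
    unfolding v_def c_def by (intro apx_sum apx_scale apx_taylor_coeff[OF hol \<rho> M r]) auto
  moreover have "cmod (contour_integral (linepath a b) (\<lambda>y. f y * E y x) - v x) * w x \<le> \<epsilon>"
    if x: "x \<in> S" for x
  proof -
    have "cball y1 (\<rho> / 2) \<subseteq> cball y1 \<rho>" using \<rho>(2) by (intro subset_cball) auto
    then have "closed_segment a b \<subseteq> U" using seg \<rho>(1) by blast
    then have cE: "continuous_on (closed_segment a b) (\<lambda>y. E y x)"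
      by (rule continuous_on_subset[OF holomorphic_on_imp_continuous_on[OF hol[OF x]]])
    have int: "(\<lambda>y. f y * (y - y1) ^ k * c k x) contour_integrable_on linepath a b" for k
      by (intro contour_integrable_continuous_linepath continuous_intros f)
    have v: "v x = contour_integral (linepath a b) (\<lambda>y. \<Sum>k<N. f y * (y - y1) ^ k * c k x)"
      unfolding v_def
      by (subst contour_integral_sum)
         (auto intro!: int sum.cong contour_integral_rmul[symmetric] contour_integrable_continuous_linepath continuous_intros f)
    define D where "D y = f y * (E y x - (\<Sum>k<N. (y - y1) ^ k * c k x)) * of_real (w x)" for y
    have "contour_integral (linepath a b) (\<lambda>y. f y * E y x) - v x
      = contour_integral (linepath a b) (\<lambda>y. f y * E y x - (\<Sum>k<N. f y * (y - y1) ^ k * c k x))"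
      unfolding v
      by (rule contour_integral_diff[symmetric])
         (intro contour_integrable_continuous_linepath continuous_intros f cE)+
    then have "(contour_integral (linepath a b) (\<lambda>y. f y * E y x) - v x) * of_real (w x)
      = contour_integral (linepath a b) (\<lambda>y. (f y * E y x - (\<Sum>k<N. f y * (y - y1) ^ k * c k x)) * of_real (w x))"
      by (simp, intro contour_integral_rmul[symmetric] contour_integrable_continuous_linepath continuous_intros f cE)
    also have "\<dots> = contour_integral (linepath a b) D"
      unfolding D_def by (simp add: right_diff_distrib sum_distrib_left mult.assoc)
    also have "cmod \<dots> \<le> (B * (M' * 2) * (1 / 2) ^ N) * cmod (b - a)"
    proof (rule contour_integral_bound_linepath)
      show "D contour_integrable_on linepath a b"
        unfolding D_def by (intro contour_integrable_continuous_linepath continuous_intros f cE)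
      show "0 \<le> B * (M' * 2) * (1 / 2) ^ N" using B(2) by (simp add: M'_def)
      fix y assume y: "y \<in> closed_segment a b"
      have "cmod (E y x - (\<Sum>k<N. (y - y1) ^ k * c k x)) * w x
          \<le> M' * ((\<rho> / 2) / \<rho>) ^ N / (1 - (\<rho> / 2) / \<rho>)"
        unfolding c_def
        by (rule taylor_tail_bound[OF hol \<rho> _ x])
           (use \<rho> M seg y in \<open>auto simp: M'_def dist_norm norm_minus_commute max.coboundedI1 subset_iff\<close>)
      also have "\<dots> = (M' * 2) * (1 / 2) ^ N" using \<rho> by simp
      finally have "cmod (f y) * (cmod (E y x - (\<Sum>k<N. (y - y1) ^ k * c k x)) * w x) \<le> B * ((M' * 2) * (1 / 2) ^ N)"
        using weight_nonneg[OF x] by (intro mult_mono[OF B(1)[OF y] _ B(2)]) auto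
      then show "cmod (D y) \<le> B * (M' * 2) * (1 / 2) ^ N"
        using weight_nonneg[OF x] by (simp add: D_def norm_mult mult_ac)
    qed
    also have "\<dots> \<le> \<epsilon>" using N by (simp add: mult_ac)
    finally show ?thesis using weight_nonneg[OF x] by (simp add: norm_mult)
  qed
  ultimately show "\<exists>v. apx v \<and> (\<forall>x\<in>S. cmod (contour_integral (linepath a b) (\<lambda>y. f y * E y x) - v x) * w x \<le> \<epsilon>)"
    by blast
qed

lemma apx_segment:
  assumes U: "open U"
    and hol: "\<And>x. x \<in> S \<Longrightarrow> (\<lambda>y. E y x) holomorphic_on U"
    and bdd: "\<And>y. y \<in> U \<Longrightarrow> \<exists>\<rho>>0. \<exists>M. cball y \<rho> \<subseteq> U \<and>
        (\<forall>z\<in>cball y \<rho>. \<forall>x\<in>S. cmod (E z x) * w x \<le> M)"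
    and E: "\<And>y. y \<in> U \<Longrightarrow> apx (E y)"
    and seg: "closed_segment a b \<subseteq> U"
    and f: "continuous_on (closed_segment a b) f"
  shows "apx (\<lambda>x. contour_integral (linepath a b) (\<lambda>y. f y * E y x))"
proof -
  define p where "p t = linepath a b t" for t
  define P where "P s t \<longleftrightarrow> 0 \<le> s \<and> t \<le> 1 \<longrightarrow>
    apx (\<lambda>x. contour_integral (linepath (p s) (p t)) (\<lambda>y. f y * E y x))" for s t
  have sub: "closed_segment (p s) (p t) = p ` {s..t}" if "s \<le> t" for s t
  proof -
    have "closed_segment (p s) (p t) = (\<lambda>u. p ((1 - u) *\<^sub>R s + u *\<^sub>R t)) ` {0..1}"
      unfolding closed_segment_image_interval
      by (intro image_cong refl) (simp add: p_def linepath_def algebra_simps)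
    also have "\<dots> = p ` closed_segment s t"
      unfolding closed_segment_image_interval by (simp add: image_image)
    also have "\<dots> = p ` {s..t}" using that by (simp add: closed_segment_eq_real_ivl)
    finally show ?thesis .
  qed
  have inseg: "closed_segment (p s) (p t) \<subseteq> closed_segment a b" if "0 \<le> s" "s \<le> t" "t \<le> 1" for s t
  proof -
    have "p v \<in> closed_segment a b" if "0 \<le> v" "v \<le> 1" for v
      using that by (simp add: p_def linepath_in_path)
    then show ?thesis using that unfolding sub[OF that(2)] by auto
  qed
  \<comment> \<open>Bisection reduces the claim to segments so short that they fit into one of the discs.\<close>
  have "P 0 1"
  proof (rule Bolzano)
    fix s t u assume trans: "P s t" "P t u" "s \<le> t" "t \<le> u"
    show "P s u"
      unfolding P_def
    proof
      assume su: "0 \<le> s \<and> u \<le> 1"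
      have "apx (\<lambda>x. contour_integral (linepath (p s) (p t)) (\<lambda>y. f y * E y x)
          + contour_integral (linepath (p t) (p u)) (\<lambda>y. f y * E y x))"
        using trans su unfolding P_def by (intro apx_add) auto
      then show "apx (\<lambda>x. contour_integral (linepath (p s) (p u)) (\<lambda>y. f y * E y x))"
      proof (rule apx_cong)
        fix x assume x: "x \<in> S"
        have "continuous_on (closed_segment (p s) (p u)) (\<lambda>y. f y * E y x)"
          using inseg[of s u] su trans seg
          by (intro continuous_intros continuous_on_subset[OF f]
              continuous_on_subset[OF holomorphic_on_imp_continuous_on[OF hol[OF x]]]) auto
        moreover have "p t \<in> closed_segment (p s) (p u)"
          using trans by (subst sub) auto
        ultimately show "contour_integral (linepath (p s) (p t)) (\<lambda>y. f y * E y x)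
          + contour_integral (linepath (p t) (p u)) (\<lambda>y. f y * E y x)
          = contour_integral (linepath (p s) (p u)) (\<lambda>y. f y * E y x)"
          by (rule contour_integral_split_linepath[symmetric])
      qed
    qed
  next
    fix s :: real assume local: "0 \<le> s" "s \<le> 1"
    have "p s \<in> U" using local seg linepath_in_path[of s a b] by (auto simp: p_def)
    then obtain \<rho> M where \<rho>: "0 < \<rho>" "cball (p s) \<rho> \<subseteq> U"
        "\<And>z x. z \<in> cball (p s) \<rho> \<Longrightarrow> x \<in> S \<Longrightarrow> cmod (E z x) * w x \<le> M"
      using bdd[of "p s"] by blast
    define d where "d = \<rho> / 2 / (cmod (b - a) + 1)"
    have "d > 0" using \<rho> by (simp add: d_def add_nonneg_pos)
    moreover have "P t u" if tu: "t \<le> s \<and> s \<le> u \<and> u - t < d" for t u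
      unfolding P_def
    proof
      assume bds: "0 \<le> t \<and> u \<le> 1"
      have "closed_segment (p t) (p u) \<subseteq> cball (p s) (\<rho> / 2)"
        unfolding sub[OF order_trans[OF tu[THEN conjunct1] tu[THEN conjunct2, THEN conjunct1]]]
      proof (clarsimp simp: dist_norm)
        fix v assume v: "t \<le> v" "v \<le> u"
        have "p s - p v = (s - v) *\<^sub>R (b - a)"
          by (simp add: p_def linepath_def algebra_simps)
        then have "cmod (p s - p v) = \<bar>s - v\<bar> * cmod (b - a)" by simp
        also have "\<dots> \<le> d * (cmod (b - a) + 1)"
          using v tu by (intro mult_mono) auto
        also have "\<dots> = \<rho> / 2"
        proof -
          have "cmod (b - a) + 1 \<noteq> 0" using norm_ge_zero[of "b - a"] by linarith
          from nonzero_eq_divide_eq[OF this] show ?thesis using d_def by blast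
        qed
        finally show "cmod (p s - p v) * 2 \<le> \<rho>" by simp
      qed
      moreover have "apx (E y)" if "y \<in> ball (p s) \<rho>" for y
        by (rule E) (use \<rho>(2) that ball_subset_cball in blast)
      ultimately show "apx (\<lambda>x. contour_integral (linepath (p t) (p u)) (\<lambda>y. f y * E y x))"
        using \<rho> tu bds
        by (intro apx_segment_local[OF hol \<rho>(2,1) _ \<rho>(1)] continuous_on_subset[OF f] inseg) auto
    qed
    ultimately show "\<exists>d>0. \<forall>t u. t \<le> s \<and> s \<le> u \<and> u - t < d \<longrightarrow> P t u" by blast
  qed simp
  then show ?thesis by (simp add: P_def p_def linepath_0' linepath_1')
qed

end

section \<open>Cauchy's formula on a square grid\<close>

text \<open>
  The plane is divided into squares of side length \<open>d\<close>. \<open>hedge\<close> and \<open>vedge\<close> integrate along the bottom and the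
  left edge of a cell, and \<open>block\<close> consists of the cell and its eight neighbours.
\<close>
definition node :: "real \<Rightarrow> int \<Rightarrow> int \<Rightarrow> complex" where
  "node d j k = Complex (d * of_int j) (d * of_int k)"

definition hedge :: "real \<Rightarrow> (complex \<Rightarrow> complex) \<Rightarrow> int \<Rightarrow> int \<Rightarrow> complex" where
  "hedge d G j k = contour_integral (linepath (node d j k) (node d (j + 1) k)) G"

definition vedge :: "real \<Rightarrow> (complex \<Rightarrow> complex) \<Rightarrow> int \<Rightarrow> int \<Rightarrow> complex" where
  "vedge d G j k = contour_integral (linepath (node d j k) (node d j (k + 1))) G"

definition cell :: "real \<Rightarrow> int \<Rightarrow> int \<Rightarrow> complex set" where
  "cell d j k = cbox (node d j k) (node d (j + 1) (k + 1))"

definition block :: "real \<Rightarrow> int \<Rightarrow> int \<Rightarrow> complex set" where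
  "block d j k = cbox (node d (j - 1) (k - 1)) (node d (j + 2) (k + 2))"

lemma Re_node [simp]: "Re (node d j k) = d * of_int j" and Im_node [simp]: "Im (node d j k) = d * of_int k"
  by (simp_all add: node_def)

lemma cell_subset_block: "0 < d \<Longrightarrow> cell d j k \<subseteq> block d j k"
  by (auto simp: cell_def block_def in_cbox_complex_iff algebra_simps)

lemma edge_subset_cell:
  assumes "0 < d"
  shows "closed_segment (node d j k) (node d (j + 1) k) \<subseteq> cell d j k"
    and "closed_segment (node d j k) (node d j (k + 1)) \<subseteq> cell d j k"
  using assms unfolding cell_def
  by (intro closed_segment_subset convex_box; simp add: in_cbox_complex_iff algebra_simps)+

lemma contour_integral_cell:
  assumes d: "0 < d" and G: "continuous_on (path_image (rectpath (node d j k) (node d (j + 1) (k + 1)))) G"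
  shows "contour_integral (rectpath (node d j k) (node d (j + 1) (k + 1))) G
    = hedge d G j k + vedge d G (j + 1) k - hedge d G j (k + 1) - vedge d G j k"
proof -
  have "Complex (d * of_int (j + 1)) (d * of_int k) = node d (j + 1) k"
    "Complex (d * of_int j) (d * of_int (k + 1)) = node d j (k + 1)"
    by (simp_all add: node_def)
  then show ?thesis
    using contour_integral_rectpath[OF _ _ G] d unfolding hedge_def vedge_def
    by (simp add: mult_left_mono)
qed

text \<open>
  A point off the grid lines is in exactly one cell. That cell contributes Cauchy's integral formula, every
  other cell contributes 0.
\<close>
lemma cell_sum_Cauchy:
  assumes d: "0 < d" and W: "F holomorphic_on W"
    and T: "finite T" "\<And>j k. (j, k) \<in> T \<Longrightarrow> cell d j k \<subseteq> W"
    and x: "\<And>j. Re x \<noteq> d * of_int j" "\<And>k. Im x \<noteq> d * of_int k"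
    and c: "(\<lfloor>Re x / d\<rfloor>, \<lfloor>Im x / d\<rfloor>) \<in> T"
  defines "G \<equiv> \<lambda>y. F y / (y - x)"
  shows "(\<Sum>(j, k)\<in>T. hedge d G j k + vedge d G (j + 1) k - hedge d G j (k + 1) - vedge d G j k)
    = 2 * pi * \<i> * F x"
proof -
  define j0 k0 where "j0 = \<lfloor>Re x / d\<rfloor>" and "k0 = \<lfloor>Im x / d\<rfloor>"
  have strict: "x \<in> box (node d j k) (node d (j + 1) (k + 1))" if "x \<in> cell d j k" for j k
    using that x(1)[of j] x(1)[of "j + 1"] x(2)[of k] x(2)[of "k + 1"]
    by (simp add: cell_def in_cbox_complex_iff in_box_complex_iff less_le)
  have incell: "x \<in> cell d j k \<longleftrightarrow> j = j0 \<and> k = k0" for j k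
  proof
    assume "x \<in> cell d j k"
    from strict[OF this] show "j = j0 \<and> k = k0"
      unfolding j0_def k0_def using d
      by (auto simp: in_box_complex_iff field_simps intro!: floor_unique[symmetric])
  next
    have "of_int j0 \<le> Re x / d" "Re x / d \<le> of_int j0 + 1" "of_int k0 \<le> Im x / d" "Im x / d \<le> of_int k0 + 1"
      unfolding j0_def k0_def by linarith+
    moreover assume "j = j0 \<and> k = k0"
    ultimately show "x \<in> cell d j k" using d
      by (simp add: cell_def in_cbox_complex_iff field_simps)
  qed
  have each: "hedge d G j k + vedge d G (j + 1) k - hedge d G j (k + 1) - vedge d G j k
      = (if (j, k) = (j0, k0) then 2 * pi * \<i> * F x else 0)" if jk: "(j, k) \<in> T" for j k
  proof -
    define a b where "a = node d j k" and "b = node d (j + 1) (k + 1)"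
    have le: "Re a \<le> Re b" "Im a \<le> Im b" using d by (simp_all add: a_def b_def mult_left_mono)
    have im: "path_image (rectpath a b) = cbox a b - box a b"
      by (rule path_image_rectpath_cbox_minus_box[OF le])
    have cellab: "cell d j k = cbox a b" by (simp add: cell_def a_def b_def)
    have x_notin: "x \<notin> path_image (rectpath a b)"
      using strict[of j k] by (auto simp: im cellab a_def[symmetric] b_def[symmetric])
    have hol: "F holomorphic_on cbox a b" using W T(2)[OF jk] holomorphic_on_subset cellab by metis
    have "path_image (rectpath a b) \<subseteq> cbox a b" using im by blast
    then have cG: "continuous_on (path_image (rectpath a b)) G"
      unfolding G_def using x_notin
      by (intro continuous_intros continuous_on_subset[OF holomorphic_on_imp_continuous_on[OF hol]]) auto
    have "contour_integral (rectpath a b) G = (if (j, k) = (j0, k0) then 2 * pi * \<i> * F x else 0)"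
    proof (cases "(j, k) = (j0, k0)")
      case True
      then have box: "x \<in> box a b" using strict[of j k] incell[of j k] by (simp add: a_def b_def)
      have "(G has_contour_integral (2 * pi * \<i> * winding_number (rectpath a b) x * F x)) (rectpath a b)"
        unfolding G_def
      proof (rule Cauchy_integral_formula_convex_simple[OF _ hol])
        show "x \<in> interior (cbox a b)" using box by (simp add: interior_cbox)
      qed (use im x_notin in \<open>auto simp: convex_box\<close>)
      then show ?thesis using winding_number_rectpath[OF box] True
        by (simp add: contour_integral_unique)
    next
      case False
      then have "x \<notin> cbox a b" using incell[of j k] by (auto simp: cellab)
      then have "G holomorphic_on cbox a b"
        unfolding G_def by (intro holomorphic_intros hol) auto
      then have "(G has_contour_integral 0) (rectpath a b)"
        by (rule Cauchy_theorem_convex_simple) (use im in \<open>auto simp: convex_box\<close>)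
      then show ?thesis using False by (auto simp: contour_integral_unique)
    qed
    then show ?thesis
      using contour_integral_cell[OF d cG[unfolded a_def b_def]] by (simp add: a_def b_def)
  qed
  have "(\<Sum>(j, k)\<in>T. hedge d G j k + vedge d G (j + 1) k - hedge d G j (k + 1) - vedge d G j k)
    = (\<Sum>jk\<in>T. if jk = (j0, k0) then 2 * pi * \<i> * F x else 0)"
  proof (rule sum.cong[OF refl])
    fix p assume "p \<in> T"
    then show "(case p of (j, k) \<Rightarrow> hedge d G j k + vedge d G (j + 1) k - hedge d G j (k + 1) - vedge d G j k)
      = (if p = (j0, k0) then 2 * pi * \<i> * F x else 0)"
      using each[of "fst p" "snd p"] by (simp only: split_def prod.collapse)
  qed
  also have "\<dots> = 2 * pi * \<i> * F x"
    using T(1) c by (simp add: j0_def k0_def)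
  finally show ?thesis .
qed

text \<open>
  An edge shared by two cells of \<open>T\<close> is traversed in both directions. What remains are the edges with
  exactly one adjacent cell in \<open>T\<close>.
\<close>
lemma sum_cells_eq_sum_edges:
  fixes h v :: "int \<Rightarrow> int \<Rightarrow> complex"
  assumes B: "finite B" "T \<subseteq> B" "\<And>j k. (j, k) \<in> T \<Longrightarrow> (j + 1, k) \<in> B \<and> (j, k + 1) \<in> B"
  shows "(\<Sum>(j, k)\<in>T. h j k + v (j + 1) k - h j (k + 1) - v j k)
    = (\<Sum>(j, k)\<in>B. (of_bool ((j, k) \<in> T) - of_bool ((j, k - 1) \<in> T)) * h j k
        + (of_bool ((j - 1, k) \<in> T) - of_bool ((j, k) \<in> T)) * v j k)"
proof -
  have T: "finite T" using B finite_subset by blast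
  have id: "(\<Sum>(j, k)\<in>B. of_bool ((j, k) \<in> T) * f j k) = (\<Sum>(j, k)\<in>T. f j k)"
    for f :: "int \<Rightarrow> int \<Rightarrow> complex"
    using B(2) by (intro sum.mono_neutral_cong_right B(1)) auto
  have shift_k: "(\<Sum>(j, k)\<in>B. of_bool ((j, k - 1) \<in> T) * f j k) = (\<Sum>(j, k)\<in>T. f j (k + 1))"
    for f :: "int \<Rightarrow> int \<Rightarrow> complex"
  proof -
    have "(\<Sum>(j, k)\<in>B. of_bool ((j, k - 1) \<in> T) * f j k) = (\<Sum>(j, k)\<in>(\<lambda>(j, k). (j, k + 1)) ` T. f j k)"
      using B(3) by (intro sum.mono_neutral_cong_right B(1)) (force split: prod.split)+
    also have "\<dots> = (\<Sum>(j, k)\<in>T. f j (k + 1))"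
      by (subst sum.reindex) (auto simp: inj_on_def split_def)
    finally show ?thesis .
  qed
  have shift_j: "(\<Sum>(j, k)\<in>B. of_bool ((j - 1, k) \<in> T) * f j k) = (\<Sum>(j, k)\<in>T. f (j + 1) k)"
    for f :: "int \<Rightarrow> int \<Rightarrow> complex"
  proof -
    have "(\<Sum>(j, k)\<in>B. of_bool ((j - 1, k) \<in> T) * f j k) = (\<Sum>(j, k)\<in>(\<lambda>(j, k). (j + 1, k)) ` T. f j k)"
      using B(3) by (intro sum.mono_neutral_cong_right B(1)) (force split: prod.split)+
    also have "\<dots> = (\<Sum>(j, k)\<in>T. f (j + 1) k)"
      by (subst sum.reindex) (auto simp: inj_on_def split_def)
    finally show ?thesis .
  qed
  show ?thesis
    using id[of h] id[of v] shift_k[of h] shift_j[of v]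
    by (simp add: split_def sum.distrib sum_subtractf left_diff_distrib)
qed

text \<open>
  Length \<open>d\<close> times the bound \<open>3 / d\<^sup>2\<close> times the area integral at each point of the segment. This is how
  hypotheses on integrals over the plane control contour integrals.
\<close>
lemma segment_integral_le_area:
  assumes d: "0 < d" and G: "G holomorphic_on Q"
    and len: "cmod (b - a) = d"
    and Q: "\<And>y. y \<in> closed_segment a b \<Longrightarrow> cbox (y - Complex d d) (y + Complex d d) \<subseteq> Q"
  shows "ennreal (d * cmod (contour_integral (linepath a b) G)) \<le> 3 * (\<integral>\<^sup>+z\<in>Q. ennreal (cmod (G z)) \<partial>lborel)"
    (is "_ \<le> 3 * ?I")
proof (cases "?I = \<infinity>")
  case False
  then obtain i where i: "0 \<le> i" "?I = ennreal i" by (cases ?I) (auto simp: top_ennreal_def)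
  have bnd: "cmod (G y) \<le> 3 * i / d\<^sup>2" if y: "y \<in> closed_segment a b" for y
  proof -
    have "ennreal (d\<^sup>2 * cmod (G y))
      \<le> 3 * (\<integral>\<^sup>+z\<in>cbox (y - Complex d d) (y + Complex d d). ennreal (cmod (G z)) \<partial>lborel)"
      by (rule submean_square[OF d holomorphic_on_subset[OF G Q[OF y]]])
    also have "\<dots> \<le> 3 * ?I"
      using Q[OF y] by (intro mult_left_mono nn_integral_mono) (auto simp: indicator_def)
    also have "\<dots> = ennreal (3 * i)" using i by (simp add: ennreal_mult)
    finally have "d\<^sup>2 * cmod (G y) \<le> 3 * i" using i by simp
    then show ?thesis using d by (simp add: field_simps)
  qed
  have sub: "closed_segment a b \<subseteq> Q"
  proof
    fix y assume y: "y \<in> closed_segment a b"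
    have "y \<in> cbox (y - Complex d d) (y + Complex d d)" using d by (simp add: in_cbox_complex_iff)
    then show "y \<in> Q" using Q[OF y] by blast
  qed
  have "cmod (contour_integral (linepath a b) G) \<le> 3 * i / d\<^sup>2 * cmod (b - a)"
    by (rule contour_integral_bound_linepath)
       (use i bnd sub G in \<open>auto intro!: contour_integrable_continuous_linepath
          intro: continuous_on_subset holomorphic_on_imp_continuous_on\<close>)
  then have "d * cmod (contour_integral (linepath a b) G) \<le> 3 * i"
    using d by (simp add: len power2_eq_square field_simps)
  then have "ennreal (d * cmod (contour_integral (linepath a b) G)) \<le> ennreal (3 * i)" by (rule ennreal_leI)
  then show ?thesis using i by (simp add: ennreal_mult)
qed (simp add: ennreal_mult_top)

lemma edge_integral_le_area:
  assumes d: "0 < d" and G: "G holomorphic_on block d j k"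
  shows "ennreal (d * cmod (hedge d G j k)) \<le> 3 * (\<integral>\<^sup>+z\<in>block d j k. ennreal (cmod (G z)) \<partial>lborel)"
    and "ennreal (d * cmod (vedge d G j k)) \<le> 3 * (\<integral>\<^sup>+z\<in>block d j k. ennreal (cmod (G z)) \<partial>lborel)"
proof -
  have sq: "cbox (y - Complex d d) (y + Complex d d) \<subseteq> block d j k" if "y \<in> cell d j k" for y
    using that d by (auto simp: cell_def block_def in_cbox_complex_iff algebra_simps)
  have "node d (j + 1) k - node d j k = of_real d" "node d j (k + 1) - node d j k = of_real d * \<i>"
    by (simp_all add: complex_eq_iff algebra_simps)
  then have len: "cmod (node d (j + 1) k - node d j k) = d" "cmod (node d j (k + 1) - node d j k) = d"
    using d by (simp_all add: norm_mult)
  show "ennreal (d * cmod (hedge d G j k)) \<le> 3 * (\<integral>\<^sup>+z\<in>block d j k. ennreal (cmod (G z)) \<partial>lborel)"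
    unfolding hedge_def using edge_subset_cell(1)[OF d] sq
    by (intro segment_integral_le_area[OF d G len(1)]) blast
  show "ennreal (d * cmod (vedge d G j k)) \<le> 3 * (\<integral>\<^sup>+z\<in>block d j k. ennreal (cmod (G z)) \<partial>lborel)"
    unfolding vedge_def using edge_subset_cell(2)[OF d] sq
    by (intro segment_integral_le_area[OF d G len(2)]) blast
qed

text \<open>
  A point lies in at most 16 blocks: its coordinates divided by \<open>d\<close> determine \<open>j\<close> and \<open>k\<close> up to an
  interval of length 3 each, which contains at most 4 integers.
\<close>
lemma sum_blocks_le:
  assumes d: "0 < d" and P: "finite P" and h [measurable]: "h \<in> borel_measurable borel"
  shows "(\<Sum>(j, k)\<in>P. \<integral>\<^sup>+z\<in>block d j k. h z \<partial>lborel) \<le> 16 * (\<integral>\<^sup>+z. h z \<partial>lborel)"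
proof -
  have [measurable]: "block d j k \<in> sets borel" for j k by (simp add: block_def)
  have "(\<Sum>(j, k)\<in>P. \<integral>\<^sup>+z\<in>block d j k. h z \<partial>lborel)
    = (\<integral>\<^sup>+z. (\<Sum>(j, k)\<in>P. h z * indicator (block d j k) z) \<partial>lborel)"
    by (simp add: split_def nn_integral_sum)
  also have "\<dots> \<le> (\<integral>\<^sup>+z. 16 * h z \<partial>lborel)"
  proof (rule nn_integral_mono)
    fix z
    define A where "A = {\<lceil>Re z / d\<rceil> - 2..\<lfloor>Re z / d\<rfloor> + 1} \<times> {\<lceil>Im z / d\<rceil> - 2..\<lfloor>Im z / d\<rfloor> + 1}"
    have "card A = nat (\<lfloor>Re z / d\<rfloor> + 1 - (\<lceil>Re z / d\<rceil> - 2) + 1) * nat (\<lfloor>Im z / d\<rfloor> + 1 - (\<lceil>Im z / d\<rceil> - 2) + 1)"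
      by (simp add: A_def card_cartesian_product)
    also have "\<dots> \<le> 4 * 4"
      by (rule mult_le_mono; simp; linarith)
    finally have cardA: "card A \<le> 16" by simp
    have inA: "(j, k) \<in> A" if "z \<in> block d j k" for j k
    proof -
      have "of_int (j - 1) \<le> Re z / d" "Re z / d \<le> of_int (j + 2)" "of_int (k - 1) \<le> Im z / d" "Im z / d \<le> of_int (k + 2)"
        using that d by (auto simp: block_def in_cbox_complex_iff field_simps)
      then have "j - 1 \<le> \<lfloor>Re z / d\<rfloor>" "\<lceil>Re z / d\<rceil> \<le> j + 2" "k - 1 \<le> \<lfloor>Im z / d\<rfloor>" "\<lceil>Im z / d\<rceil> \<le> k + 2"
        by (simp_all only: le_floor_iff ceiling_le_iff)
      then show ?thesis by (auto simp: A_def)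
    qed
    have "(\<Sum>(j, k)\<in>P. h z * indicator (block d j k) z) \<le> (\<Sum>jk\<in>P. h z * indicator A jk)"
      using inA by (intro sum_mono) (auto simp: indicator_def)
    also have "\<dots> = (\<Sum>jk\<in>P \<inter> A. h z)"
      using P by (intro sum.mono_neutral_cong_right) (auto simp: indicator_def)
    also have "\<dots> = of_nat (card (P \<inter> A)) * h z" by simp
    also have "\<dots> \<le> of_nat 16 * h z"
    proof (intro mult_right_mono of_nat_mono)
      have "card (P \<inter> A) \<le> card A" by (intro card_mono) (auto simp: A_def)
      then show "card (P \<inter> A) \<le> 16" using cardA by simp
    qed simp
    finally show "(\<Sum>(j, k)\<in>P. h z * indicator (block d j k) z) \<le> 16 * h z" by simp
  qed
  also have "\<dots> = 16 * (\<integral>\<^sup>+z. h z \<partial>lborel)" by (simp add: nn_integral_cmult)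
  finally show ?thesis .
qed

section \<open>Weighted Runge approximation\<close>

lemma block_indices_bounded:
  assumes d: "0 < d" and K: "bounded K"
  obtains m :: int where "\<And>j k. block d j k \<inter> K \<noteq> {} \<Longrightarrow> \<bar>j\<bar> \<le> m \<and> \<bar>k\<bar> \<le> m"
proof -
  obtain \<rho> where \<rho>: "\<And>z. z \<in> K \<Longrightarrow> cmod z \<le> \<rho>" using K unfolding bounded_iff by blast
  have "\<bar>j\<bar> \<le> \<lceil>\<rho> / d\<rceil> + 2 \<and> \<bar>k\<bar> \<le> \<lceil>\<rho> / d\<rceil> + 2" if "block d j k \<inter> K \<noteq> {}" for j k
  proof -
    obtain z where z: "z \<in> block d j k" "z \<in> K" using \<open>block d j k \<inter> K \<noteq> {}\<close> by blast
    have "\<bar>Re z\<bar> \<le> \<rho>" "\<bar>Im z\<bar> \<le> \<rho>"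
      using \<rho>[OF z(2)] abs_Re_le_cmod[of z] abs_Im_le_cmod[of z] by linarith+
    then have "- \<rho> / d \<le> Re z / d" "Re z / d \<le> \<rho> / d" "- \<rho> / d \<le> Im z / d" "Im z / d \<le> \<rho> / d"
      using d by (simp_all add: field_simps abs_le_iff)
    moreover have "of_int (j - 1) \<le> Re z / d" "Re z / d \<le> of_int (j + 2)"
      "of_int (k - 1) \<le> Im z / d" "Im z / d \<le> of_int (k + 2)"
      using z(1) d by (auto simp: block_def in_cbox_complex_iff field_simps)
    ultimately show ?thesis by (intro conjI abs_leI; simp; linarith)
  qed
  then show thesis using that by blast
qed

lemma dist_node_block:
  assumes "0 < d" "y \<in> block d j k"
  shows "cmod (y - node d j k) \<le> 4 * d" "cmod (y - node d (j - 1) k) \<le> 5 * d" "cmod (y - node d j (k - 1)) \<le> 5 * d"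
proof -
  have b: "d * (of_int j - 1) \<le> Re y" "Re y \<le> d * (of_int j + 2)" "d * (of_int k - 1) \<le> Im y" "Im y \<le> d * (of_int k + 2)"
    using assms by (auto simp: block_def in_cbox_complex_iff)
  have "\<bar>Re y - d * of_int j\<bar> \<le> 2 * d" "\<bar>Im y - d * of_int k\<bar> \<le> 2 * d"
    "\<bar>Re y - d * of_int (j - 1)\<bar> \<le> 3 * d" "\<bar>Im y - d * of_int (k - 1)\<bar> \<le> 3 * d"
    using b assms(1) by (auto simp: abs_le_iff algebra_simps)
  then show "cmod (y - node d j k) \<le> 4 * d" "cmod (y - node d (j - 1) k) \<le> 5 * d" "cmod (y - node d j (k - 1)) \<le> 5 * d"
    using cmod_le[of "y - node d j k"] cmod_le[of "y - node d (j - 1) k"] cmod_le[of "y - node d j (k - 1)"]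
    by simp_all
qed

lemma holomorphic_on_reflect_shift:
  assumes "g holomorphic_on UNIV"
  shows "(\<lambda>y. g (x - y)) holomorphic_on Q"
proof -
  have "(\<lambda>y. x - y) holomorphic_on Q" by (intro holomorphic_intros)
  from holomorphic_on_compose_gen[OF this assms] show ?thesis by (simp add: o_def)
qed

text \<open>
  Only countably many diagonal translates of \<open>x\<close> meet a grid line.
\<close>
lemma off_grid_point_near:
  assumes "0 < d" "0 < e"
  obtains y where "dist x y < e" "\<And>j. Re y \<noteq> d * of_int j" "\<And>k. Im y \<noteq> d * of_int k"
proof -
  define C where "C = range (\<lambda>j::int. d * of_int j - Re x) \<union> range (\<lambda>j::int. d * of_int j - Im x)"
  have "countable C" by (simp add: C_def)
  moreover have "uncountable {0<..<e / 2}" using assms by (simp add: uncountable_open_interval)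
  ultimately have "\<not> {0<..<e / 2} \<subseteq> C" using countable_subset by blast
  then obtain t where t': "t \<in> {0<..<e / 2}" "t \<notin> C" by blast
  then have t: "0 < t" "t < e / 2" "t \<notin> C" by simp_all
  have "dist x (x + Complex t t) \<le> \<bar>t\<bar> + \<bar>t\<bar>"
    using cmod_le[of "Complex t t"] by (simp add: dist_norm)
  then have "dist x (x + Complex t t) < e" using t by simp
  moreover have "Re (x + Complex t t) \<noteq> d * of_int j" "Im (x + Complex t t) \<noteq> d * of_int j" for j
    using t(3) by (auto simp: C_def image_iff algebra_simps)
  ultimately show thesis using that by blast
qed

context weighted_closure
begin

lemma apx_edge_family:
  assumes U: "open U"
    and hol: "\<And>x. x \<in> S \<Longrightarrow> (\<lambda>y. E y x) holomorphic_on U"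
    and bdd: "\<And>y. y \<in> U \<Longrightarrow> \<exists>\<rho>>0. \<exists>M. cball y \<rho> \<subseteq> U \<and>
        (\<forall>z\<in>cball y \<rho>. \<forall>x\<in>S. cmod (E z x) * w x \<le> M)"
    and E: "\<And>y. y \<in> U \<Longrightarrow> apx (E y)"
    and d: "0 < d"
    and c: "c \<noteq> 0 \<Longrightarrow> cell d j k \<subseteq> U \<and> continuous_on (cell d j k) f"
  shows "apx (\<lambda>x. c * hedge d (\<lambda>y. f y * E y x) j k)" "apx (\<lambda>x. c * vedge d (\<lambda>y. f y * E y x) j k)"
proof -
  have "apx (\<lambda>x. 0)" by (intro apx_mem zero_mem)
  moreover have "apx (\<lambda>x. contour_integral (linepath p q) (\<lambda>y. f y * E y x))"
    if "c \<noteq> 0" "closed_segment p q \<subseteq> cell d j k" for p q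
  proof (rule apx_segment[OF U hol bdd E])
    show "closed_segment p q \<subseteq> U" "continuous_on (closed_segment p q) f"
      using c[OF that(1)] that(2) continuous_on_subset by blast+
  qed
  then have "apx (\<lambda>x. hedge d (\<lambda>y. f y * E y x) j k)" "apx (\<lambda>x. vedge d (\<lambda>y. f y * E y x) j k)" if "c \<noteq> 0"
    unfolding hedge_def vedge_def using that edge_subset_cell[OF d, of j k] by blast+
  ultimately show "apx (\<lambda>x. c * hedge d (\<lambda>y. f y * E y x) j k)" "apx (\<lambda>x. c * vedge d (\<lambda>y. f y * E y x) j k)"
    by (cases "c = 0"; simp add: apx_scale)+
qed

text \<open>
  Weighted Runge approximation. Take the cells close to \<open>S\<close>, cut off by a large box. Off the grid,
  Cauchy's formula with the factor \<open>g (x - y)\<close>, which is 1 at \<open>y = x\<close>, writes \<open>f x\<close> as a sum over the remaining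
  edges. Finitely many edges have blocks that meet the compact set \<open>K\<close>; their contributions are superpositions of
  the kernels with poles \<open>y\<close> off the closure of \<open>S\<close> and hence in the closure of \<open>H\<close>. Outside of \<open>K\<close> the
  function \<open>cmod (f y) * u y\<close> is small, so the area bounds and the integral bound \<open>A\<close> make all other edges together
  small, no matter how large the box is. The box may therefore depend on \<open>x\<close>, whereas the approximating function \<open>a\<close>
  does not. Points on the grid lines are reached by continuity.
\<close>
lemma apx_restrict_holomorphic:
  fixes g :: "complex \<Rightarrow> complex" and f :: "complex \<Rightarrow> complex" and u :: "complex \<Rightarrow> real"
  assumes S: "open S" and W: "open W" and d0: "0 < d0" "\<And>x. x \<in> S \<Longrightarrow> ball x d0 \<subseteq> W"
    and g: "g holomorphic_on UNIV" "g 0 = 1"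
    and f: "f holomorphic_on W"
    and u: "continuous_on W u" "\<And>y. y \<in> W \<Longrightarrow> 0 < u y"
    and w: "continuous_on S w"
    and small: "\<And>\<eta>. 0 < \<eta> \<Longrightarrow> \<exists>K. compact K \<and> (\<forall>y\<in>W - K. cmod (f y) * u y \<le> \<eta>)"
    and A: "0 < A" "\<And>x. x \<in> S \<Longrightarrow>
      (\<integral>\<^sup>+y\<in>W. ennreal (cmod (g (x - y)) * w x / (cmod (x - y) * u y)) \<partial>lborel) \<le> ennreal A"
    and H: "\<And>a. a \<in> H \<Longrightarrow> continuous_on S a"
    and bdd: "\<And>y. y \<in> - closure S \<Longrightarrow> \<exists>\<rho>>0. \<exists>M. cball y \<rho> \<subseteq> - closure S \<and>
        (\<forall>z\<in>cball y \<rho>. \<forall>x\<in>S. cmod (g (x - z) / (x - z)) * w x \<le> M)"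
    and E: "\<And>y. y \<in> - closure S \<Longrightarrow> apx (\<lambda>x. g (x - y) / (x - y))"
  shows "apx f"
  unfolding approx_in_def
proof (intro allI impI)
  fix \<epsilon> :: real assume e: "0 < \<epsilon>"
  define U where "U = - closure S"
  \<comment> \<open>A block is within \<open>5 * d\<close> of the nodes of the cells next to its edges. With threshold \<open>6 * d\<close> for
    \<open>near\<close>, the blocks of boundary edges stay away from \<open>S\<close> by \<open>d\<close> and within \<open>11 * d < d0\<close> of \<open>S\<close>.\<close>
  define d where "d = d0 / 12"
  have d: "0 < d" using d0 by (simp add: d_def)
  define near where "near c \<longleftrightarrow> (\<exists>z\<in>S. dist (node d (fst c) (snd c)) z < 6 * d)" for c
  have near_block: "block d j k \<subseteq> W"
    if n: "near (j, k) \<or> near (j - 1, k) \<or> near (j, k - 1)" for j k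
  proof
    fix y assume y: "y \<in> block d j k"
    have "cmod (y - node d j k) \<le> 5 * d" using dist_node_block(1)[OF d y] d by simp
    then obtain c z where c: "cmod (y - c) \<le> 5 * d" and z: "z \<in> S" "dist c z < 6 * d"
      using n dist_node_block(2,3)[OF d y] unfolding near_def fst_conv snd_conv by metis
    have "dist z y < 11 * d"
      using c z(2) norm_triangle_ineq[of "y - c" "c - z"] by (simp add: dist_norm norm_minus_commute)
    then have "dist z y < d0" using d by (simp add: d_def)
    then show "y \<in> W" using d0(2)[OF z(1)] by (auto simp: dist_commute)
  qed
  have far_block: "block d j k \<inter> S = {} \<and> block d j k \<subseteq> U"
    if n: "\<not> near (j, k) \<or> \<not> near (j - 1, k) \<or> \<not> near (j, k - 1)" for j k
  proof -
    have "d \<le> dist y z" if y: "y \<in> block d j k" and z: "z \<in> S" for y z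
    proof -
      have "cmod (y - node d j k) \<le> 5 * d" using dist_node_block(1)[OF d y] d by simp
      then obtain c where c: "cmod (y - c) \<le> 5 * d" "6 * d \<le> dist c z"
        using n dist_node_block(2,3)[OF d y] z unfolding near_def fst_conv snd_conv by (metis not_le)
      then show ?thesis
        using norm_triangle_ineq[of "c - y" "y - z"] by (simp add: dist_norm norm_minus_commute)
    qed
    then have "y \<notin> closure S" if "y \<in> block d j k" for y
      using that d unfolding closure_approachable by (metis dist_commute not_le)
    then show ?thesis unfolding U_def using closure_subset by blast
  qed
  define G where "G x y = f y * (g (x - y) / (x - y))" for x y
  have holG: "G x holomorphic_on Q" if "Q \<subseteq> W" "x \<notin> Q" for x Q
    unfolding G_def using that
    by (intro holomorphic_intros holomorphic_on_subset[OF f] holomorphic_on_reflect_shift[OF g(1)]) auto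
  \<comment> \<open>The tail estimate below loses a factor 16 for overlapping blocks, a factor 6 for the two edges of a
    block with factor 3 each, and gains \<open>2 * pi \<ge> 6\<close> from Cauchy's formula.\<close>
  define \<eta> where "\<eta> = \<epsilon> / 2 * d / (16 * A)"
  have \<eta>: "0 < \<eta>" using e d A(1) by (simp add: \<eta>_def)
  obtain K where K: "compact K" "\<And>y. y \<in> W \<Longrightarrow> y \<notin> K \<Longrightarrow> cmod (f y) * u y \<le> \<eta>"
    using small[OF \<eta>] by blast
  define P where "P = {(j, k). block d j k \<inter> K \<noteq> {}}"
  obtain m :: int where m: "\<And>j k. block d j k \<inter> K \<noteq> {} \<Longrightarrow> \<bar>j\<bar> \<le> m \<and> \<bar>k\<bar> \<le> m"
    using block_indices_bounded[OF d compact_imp_bounded[OF K(1)]] by metis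
  have "P \<subseteq> {-m..m} \<times> {-m..m}" using m by (fastforce simp: P_def abs_le_iff)
  then have finP: "finite P" by (rule finite_subset) simp
  define sh sv :: "(int \<times> int \<Rightarrow> bool) \<Rightarrow> int \<Rightarrow> int \<Rightarrow> complex"
    where "sh T j k = of_bool (T (j, k)) - of_bool (T (j, k - 1))"
      and "sv T j k = of_bool (T (j - 1, k)) - of_bool (T (j, k))" for T j k
  define a where "a x = - 1 / (2 * pi * \<i>) *
    (\<Sum>(j, k)\<in>P. sh near j k * hedge d (G x) j k + sv near j k * vedge d (G x) j k)" for x
  have "apx a"
    unfolding a_def
  proof (intro apx_scale apx_sum finP)
    fix c assume "c \<in> P"
    obtain j k where c: "c = (j, k)" by force
    have hol: "(\<lambda>y. g (x - y) / (x - y)) holomorphic_on U" if "x \<in> S" for x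
      using that closure_subset unfolding U_def
      by (intro holomorphic_intros holomorphic_on_reflect_shift[OF g(1)]) auto
    have *: "cell d j k \<subseteq> U \<and> continuous_on (cell d j k) f" if "sh near j k \<noteq> 0 \<or> sv near j k \<noteq> 0"
    proof -
      have "near (j, k) \<or> near (j - 1, k) \<or> near (j, k - 1)" "\<not> near (j, k) \<or> \<not> near (j - 1, k) \<or> \<not> near (j, k - 1)"
        using that by (auto simp: sh_def sv_def of_bool_def split: if_splits)
      from near_block[OF this(1)] far_block[OF this(2)] show ?thesis
        using cell_subset_block[OF d, of j k] f
        by (meson continuous_on_subset holomorphic_on_imp_continuous_on order_trans)
    qed
    have "apx (\<lambda>x. sh near j k * hedge d (\<lambda>y. f y * (g (x - y) / (x - y))) j k)"
      by (rule apx_edge_family(1)[OF _ hol _ _ d]) (use bdd E * in \<open>auto simp: U_def\<close>)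
    moreover have "apx (\<lambda>x. sv near j k * vedge d (\<lambda>y. f y * (g (x - y) / (x - y))) j k)"
      by (rule apx_edge_family(2)[OF _ hol _ _ d]) (use bdd E * in \<open>auto simp: U_def\<close>)
    ultimately show "apx (\<lambda>x. case c of (j, k) \<Rightarrow> sh near j k * hedge d (G x) j k + sv near j k * vedge d (G x) j k)"
      unfolding c G_def by (simp add: apx_add)
  qed
  then obtain b where b: "b \<in> H" "\<And>x. x \<in> S \<Longrightarrow> cmod (a x - b x) * w x \<le> \<epsilon> / 2"
    unfolding approx_in_def using e by (meson half_gt_zero)
  have main: "cmod (f x - a x) * w x \<le> \<epsilon> / 2"
    if x: "x \<in> S" and off: "\<And>j. Re x \<noteq> d * of_int j" "\<And>k. Im x \<noteq> d * of_int k" for x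
  proof -
    \<comment> \<open>The box contains the cell of \<open>x\<close> and all edges that occur in \<open>a\<close>, and its rim is far from \<open>x\<close>.\<close>
    define R where "R = max (m + 1) \<lceil>(cmod x + 10 * d) / d\<rceil>"
    have "(cmod x + 10 * d) / d \<le> of_int R" unfolding R_def by linarith
    then have R: "cmod x + 10 * d \<le> d * of_int R" using d by (simp add: field_simps)
    define T where "T = {c. near c} \<inter> {-R..R} \<times> {-R..R}"
    define B where "B = {-R..R+1} \<times> {-R..R+1}"
    have finB: "finite B" by (simp add: B_def)
    have TB: "T \<subseteq> B" "\<And>j k. (j, k) \<in> T \<Longrightarrow> (j + 1, k) \<in> B \<and> (j, k + 1) \<in> B"
      by (auto simp: T_def B_def)
    have PB: "P \<subseteq> B" using m by (fastforce simp: P_def B_def R_def abs_le_iff)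
    have onP: "(j, k) \<in> T \<longleftrightarrow> near (j, k)" "(j - 1, k) \<in> T \<longleftrightarrow> near (j - 1, k)" "(j, k - 1) \<in> T \<longleftrightarrow> near (j, k - 1)"
      if "(j, k) \<in> P" for j k
      using m[of j k] that by (auto simp: T_def P_def R_def abs_le_iff max_def)
    define \<sigma> \<tau> where "\<sigma> = sh (\<lambda>c. c \<in> T)" and "\<tau> = sv (\<lambda>c. c \<in> T)"
    define t where "t j k = \<sigma> j k * hedge d (G x) j k + \<tau> j k * vedge d (G x) j k" for j k
    have xT: "(\<lfloor>Re x / d\<rfloor>, \<lfloor>Im x / d\<rfloor>) \<in> T"
    proof -
      define j k where "j = \<lfloor>Re x / d\<rfloor>" and "k = \<lfloor>Im x / d\<rfloor>"
      have "of_int j \<le> Re x / d" "Re x / d \<le> of_int j + 1" "of_int k \<le> Im x / d" "Im x / d \<le> of_int k + 1"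
        unfolding j_def k_def by linarith+
      then have jk: "d * of_int j \<le> Re x" "Re x \<le> d * (of_int j + 1)" "d * of_int k \<le> Im x" "Im x \<le> d * (of_int k + 1)"
        using d by (simp_all add: field_simps)
      then have "x \<in> block d j k" using d by (simp add: block_def in_cbox_complex_iff algebra_simps)
      then have "near (j, k)"
        using dist_node_block(1)[OF d, of x j k] x d by (auto simp: near_def dist_norm norm_minus_commute intro!: bexI[of _ x])
      moreover have ineq: "d * of_int j \<le> d * of_int R" "- (d * of_int R) \<le> d * of_int j"
        "d * of_int k \<le> d * of_int R" "- (d * of_int R) \<le> d * of_int k"
        using jk[unfolded distrib_left] R abs_Re_le_cmod[of x] abs_Im_le_cmod[of x] d by linarith+
      have "d * of_int (- R) \<le> d * of_int j" "d * of_int (- R) \<le> d * of_int k" using ineq by simp_all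
      then have "j \<le> R" "- R \<le> j" "k \<le> R" "- R \<le> k"
        using ineq(1,3) d by (simp_all only: mult_le_cancel_left_pos of_int_le_iff)
      ultimately show ?thesis unfolding j_def[symmetric] k_def[symmetric] by (simp add: T_def)
    qed
    \<comment> \<open>The sign makes Cauchy's kernel \<open>1 / (y - x)\<close> agree with the kernel \<open>g (x - y) / (x - y)\<close>.\<close>
    have xG: "(\<lambda>y. (- f y * g (x - y)) / (y - x)) = G x"
    proof
      fix y show "(- f y * g (x - y)) / (y - x) = G x y"
        unfolding G_def by (metis minus_diff_eq minus_divide_divide mult_minus_left times_divide_eq_right)
    qed
    have cauchy: "- (2 * pi * \<i> * f x) = (\<Sum>(j, k)\<in>B. t j k)"
    proof -
      have "(\<lambda>y. - f y * g (x - y)) holomorphic_on W"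
        by (intro holomorphic_intros f holomorphic_on_reflect_shift[OF g(1)])
      moreover have "cell d j k \<subseteq> W" if "(j, k) \<in> T" for j k
        using near_block[of j k] cell_subset_block[OF d, of j k] that by (auto simp: T_def)
      ultimately have "(\<Sum>(j, k)\<in>T. hedge d (G x) j k + vedge d (G x) (j + 1) k - hedge d (G x) j (k + 1) - vedge d (G x) j k)
        = 2 * pi * \<i> * (- f x * g (x - x))"
        using cell_sum_Cauchy[OF d, where F = "\<lambda>y. - f y * g (x - y)" and W = W and T = T and x = x]
          off xT finite_subset[OF TB(1) finB] unfolding xG by blast
      also have "(\<Sum>(j, k)\<in>T. hedge d (G x) j k + vedge d (G x) (j + 1) k - hedge d (G x) j (k + 1) - vedge d (G x) j k)
        = (\<Sum>(j, k)\<in>B. t j k)"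
        unfolding t_def \<sigma>_def \<tau>_def sh_def sv_def by (rule sum_cells_eq_sum_edges[OF finB TB])
      finally show ?thesis using g(2) by simp
    qed
    have "a x * (2 * pi * \<i>) = - (\<Sum>(j, k)\<in>P. t j k)"
    proof -
      have "(\<Sum>(j, k)\<in>P. t j k) = (\<Sum>(j, k)\<in>P. sh near j k * hedge d (G x) j k + sv near j k * vedge d (G x) j k)"
        by (rule sum.cong) (auto simp: t_def \<sigma>_def \<tau>_def sh_def sv_def onP)
      then show ?thesis by (simp add: a_def)
    qed
    then have "- (f x - a x) * (2 * pi * \<i>) = (\<Sum>(j, k)\<in>B. t j k) - (\<Sum>(j, k)\<in>P. t j k)"
      using cauchy by (simp add: algebra_simps)
    also have "\<dots> = (\<Sum>(j, k)\<in>B - P. t j k)"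
      using sum_diff[OF finB PB, of "\<lambda>(j, k). t j k"] by simp
    finally have "cmod (- (f x - a x) * (2 * pi * \<i>)) = cmod (\<Sum>(j, k)\<in>B - P. t j k)" by simp
    then have diff: "2 * pi * cmod (f x - a x) \<le> (\<Sum>(j, k)\<in>B - P. cmod (t j k))"
      using sum_norm_le[of "B - P" "\<lambda>(j, k). t j k" "\<lambda>(j, k). cmod (t j k)"]
      by (simp add: norm_mult norm_minus_commute split_def mult.commute)
    define \<phi> where "\<phi> y = ennreal (cmod (g (x - y)) * w x / (cmod (x - y) * u y)) * indicator W y" for y
    have \<phi>_meas [measurable]: "\<phi> \<in> borel_measurable borel"
    proof -
      have [measurable]: "(\<lambda>y. g (x - y)) \<in> borel_measurable borel"
        by (intro borel_measurable_continuous_onI continuous_on_compose2[OF holomorphic_on_imp_continuous_on[OF g(1)]] continuous_intros) auto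
      have [measurable]: "(\<lambda>y. indicator W y *\<^sub>R (1 / u y)) \<in> borel_measurable borel"
        using W u by (intro borel_measurable_continuous_on_indicator continuous_intros) force+
      have \<phi>_eq: "\<phi> = (\<lambda>y. ennreal (cmod (g (x - y)) * w x / cmod (x - y) * (indicator W y *\<^sub>R (1 / u y))))"
        by (auto simp: \<phi>_def indicator_def)
      show ?thesis unfolding \<phi>_eq by measurable
    qed
    have wx: "0 \<le> w x" by (rule weight_nonneg[OF x])
    have tail: "ennreal (d * (w x * cmod (t j k))) \<le> ennreal (6 * \<eta>) * (\<integral>\<^sup>+y\<in>block d j k. \<phi> y \<partial>lborel)"
      if jk: "(j, k) \<in> B - P" for j k
    proof (cases "\<sigma> j k = 0 \<and> \<tau> j k = 0")
      case False
      then have nn: "(j, k) \<in> T \<or> (j - 1, k) \<in> T \<or> (j, k - 1) \<in> T" "(j, k) \<notin> T \<or> (j - 1, k) \<notin> T \<or> (j, k - 1) \<notin> T"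
        by (auto simp: \<sigma>_def \<tau>_def sh_def sv_def of_bool_def split: if_splits)
      have bW: "block d j k \<subseteq> W" using nn(1) near_block[of j k] by (auto simp: T_def)
      have bK: "block d j k \<inter> K = {}" using jk by (auto simp: P_def)
      have xb: "x \<notin> block d j k"
      proof
        assume xb: "x \<in> block d j k"
        show False
        proof (cases "\<not> near (j, k) \<or> \<not> near (j - 1, k) \<or> \<not> near (j, k - 1)")
          case True
          from far_block[OF this] xb x show False by blast
        next
          case False
          then have "R < \<bar>j\<bar> \<or> R < \<bar>k\<bar> \<or> R < \<bar>j - 1\<bar> \<or> R < \<bar>k - 1\<bar>"
            using nn(2) by (auto simp: T_def abs_if)
          then have "R + 1 \<le> \<bar>j\<bar> + 1 \<or> R + 1 \<le> \<bar>k\<bar> + 1" by linarith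
          then have "d * of_int R \<le> d * \<bar>of_int j\<bar> \<or> d * of_int R \<le> d * \<bar>of_int k\<bar>"
            using d by auto
          moreover have "d * \<bar>of_int j\<bar> \<le> cmod (node d j k)" "d * \<bar>of_int k\<bar> \<le> cmod (node d j k)"
            using abs_Re_le_cmod[of "node d j k"] abs_Im_le_cmod[of "node d j k"] d by (simp_all add: abs_mult)
          ultimately have "d * of_int R \<le> cmod (node d j k)" by linarith
          moreover have "cmod (node d j k) \<le> cmod x + 4 * d"
            using dist_node_block(1)[OF d xb] norm_triangle_ineq2[of "node d j k" x] by (simp add: norm_minus_commute)
          ultimately show False using R d by linarith
        qed
      qed
      have hol: "G x holomorphic_on block d j k" by (rule holG[OF bW xb])
      have pw: "ennreal (w x) * (ennreal (cmod (G x y)) * indicator (block d j k) y)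
          \<le> ennreal \<eta> * (\<phi> y * indicator (block d j k) y)" for y
      proof (cases "y \<in> block d j k")
        case True
        then have y: "y \<in> W" "y \<notin> K" "y \<noteq> x" using bW bK xb by auto
        have uy: "0 < u y" using u(2)[OF y(1)] .
        have "w x * cmod (G x y) = (cmod (f y) * u y) * (cmod (g (x - y)) * w x / (cmod (x - y) * u y))"
          using uy by (simp add: G_def norm_mult norm_divide)
        also have "\<dots> \<le> \<eta> * (cmod (g (x - y)) * w x / (cmod (x - y) * u y))"
          using K(2)[OF y(1,2)] wx uy by (intro mult_right_mono) auto
        finally have "ennreal (w x * cmod (G x y)) \<le> ennreal (\<eta> * (cmod (g (x - y)) * w x / (cmod (x - y) * u y)))"
          by (rule ennreal_leI)
        then have "ennreal (w x) * ennreal (cmod (G x y))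
            \<le> ennreal \<eta> * ennreal (cmod (g (x - y)) * w x / (cmod (x - y) * u y))"
          using wx \<eta> uy by (subst (1 2) ennreal_mult[symmetric]) auto
        then show ?thesis using True y(1) by (simp add: \<phi>_def)
      qed simp
      have int: "ennreal (w x) * (\<integral>\<^sup>+y\<in>block d j k. ennreal (cmod (G x y)) \<partial>lborel)
          \<le> ennreal \<eta> * (\<integral>\<^sup>+y\<in>block d j k. \<phi> y \<partial>lborel)"
      proof -
        have [measurable]: "block d j k \<in> sets borel" by (simp add: block_def)
        have "continuous_on (block d j k) (\<lambda>y. cmod (G x y))"
          by (intro continuous_intros holomorphic_on_imp_continuous_on[OF hol])
        then have [measurable]: "(\<lambda>y. indicator (block d j k) y *\<^sub>R cmod (G x y)) \<in> borel_measurable borel"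
          by (intro borel_measurable_continuous_on_indicator) (auto simp: block_def)
        have "(\<lambda>y. ennreal (indicator (block d j k) y *\<^sub>R cmod (G x y))) \<in> borel_measurable borel" by measurable
        also have "(\<lambda>y. ennreal (indicator (block d j k) y *\<^sub>R cmod (G x y)))
            = (\<lambda>y. ennreal (cmod (G x y)) * indicator (block d j k) y)"
          by (auto simp: indicator_def)
        finally have "ennreal (w x) * (\<integral>\<^sup>+y\<in>block d j k. ennreal (cmod (G x y)) \<partial>lborel)
          = (\<integral>\<^sup>+y. ennreal (w x) * (ennreal (cmod (G x y)) * indicator (block d j k) y) \<partial>lborel)"
          by (intro nn_integral_cmult[symmetric]) simp
        also have "\<dots> \<le> (\<integral>\<^sup>+y. ennreal \<eta> * (\<phi> y * indicator (block d j k) y) \<partial>lborel)"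
          by (rule nn_integral_mono) (rule pw)
        also have "\<dots> = ennreal \<eta> * (\<integral>\<^sup>+y\<in>block d j k. \<phi> y \<partial>lborel)"
          by (rule nn_integral_cmult) measurable
        finally show ?thesis .
      qed
      have "cmod (t j k) \<le> cmod (hedge d (G x) j k) + cmod (vedge d (G x) j k)"
      proof -
        have "cmod (\<sigma> j k) \<le> 1" "cmod (\<tau> j k) \<le> 1"
          by (auto simp: \<sigma>_def \<tau>_def sh_def sv_def of_bool_def)
        then have "cmod (\<sigma> j k) * cmod (hedge d (G x) j k) \<le> 1 * cmod (hedge d (G x) j k)"
          "cmod (\<tau> j k) * cmod (vedge d (G x) j k) \<le> 1 * cmod (vedge d (G x) j k)"
          by (simp_all only: mult_right_mono norm_ge_zero)
        then show ?thesis
          using norm_triangle_ineq[of "\<sigma> j k * hedge d (G x) j k" "\<tau> j k * vedge d (G x) j k"]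
          unfolding t_def norm_mult by linarith
      qed
      then have "d * (w x * cmod (t j k)) \<le> d * (w x * (cmod (hedge d (G x) j k) + cmod (vedge d (G x) j k)))"
        using d wx by (intro mult_left_mono) auto
      then have "ennreal (d * (w x * cmod (t j k)))
        \<le> ennreal (w x * (d * cmod (hedge d (G x) j k) + d * cmod (vedge d (G x) j k)))"
        by (intro ennreal_leI) (simp add: algebra_simps)
      also have "\<dots> = ennreal (w x) * (ennreal (d * cmod (hedge d (G x) j k)) + ennreal (d * cmod (vedge d (G x) j k)))"
        using wx d by (simp add: ennreal_mult)
      also have "\<dots> \<le> ennreal (w x) * (3 * (\<integral>\<^sup>+y\<in>block d j k. ennreal (cmod (G x y)) \<partial>lborel)
          + 3 * (\<integral>\<^sup>+y\<in>block d j k. ennreal (cmod (G x y)) \<partial>lborel))"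
        by (intro mult_left_mono add_mono edge_integral_le_area[OF d hol]) simp
      also have "\<dots> = 6 * (ennreal (w x) * (\<integral>\<^sup>+y\<in>block d j k. ennreal (cmod (G x y)) \<partial>lborel))"
      proof -
        have "a * (3 * b + 3 * b) = 6 * (a * b)" for a b :: ennreal
        proof -
          have "3 * b + 3 * b = (3 + 3) * b" by (simp only: distrib_right)
          then show ?thesis by (simp add: mult.left_commute)
        qed
        then show ?thesis .
      qed
      also have "\<dots> \<le> 6 * (ennreal \<eta> * (\<integral>\<^sup>+y\<in>block d j k. \<phi> y \<partial>lborel))"
        by (intro mult_left_mono int) simp
      also have "\<dots> = ennreal (6 * \<eta>) * (\<integral>\<^sup>+y\<in>block d j k. \<phi> y \<partial>lborel)"
        using \<eta> by (simp add: ennreal_mult mult.assoc)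
      finally show ?thesis .
    qed (simp add: t_def)
    have "ennreal (d * (w x * (\<Sum>(j, k)\<in>B - P. cmod (t j k)))) = (\<Sum>(j, k)\<in>B - P. ennreal (d * (w x * cmod (t j k))))"
      using d wx by (simp add: sum_distrib_left split_def sum_ennreal)
    also have "\<dots> \<le> (\<Sum>(j, k)\<in>B - P. ennreal (6 * \<eta>) * (\<integral>\<^sup>+y\<in>block d j k. \<phi> y \<partial>lborel))"
      by (intro sum_mono) (use tail in auto)
    also have "\<dots> = ennreal (6 * \<eta>) * (\<Sum>(j, k)\<in>B - P. \<integral>\<^sup>+y\<in>block d j k. \<phi> y \<partial>lborel)"
      by (simp add: sum_distrib_left split_def)
    also have "\<dots> \<le> ennreal (6 * \<eta>) * (16 * (\<integral>\<^sup>+y. \<phi> y \<partial>lborel))"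
      by (intro mult_left_mono sum_blocks_le[OF d _ \<phi>_meas]) (use finB in auto)
    also have "\<dots> \<le> ennreal (6 * \<eta>) * (16 * ennreal A)"
      using A(2)[OF x] unfolding \<phi>_def by (intro mult_left_mono) auto
    also have "\<dots> = ennreal (6 * \<eta> * (16 * A))"
    proof -
      have "16 * ennreal A = ennreal (16 * A)" using A(1) by (simp add: ennreal_mult)
      then show ?thesis using \<eta> A(1) by (simp only: ennreal_mult[of "6 * \<eta>" "16 * A"])
    qed
    finally have "d * (w x * (\<Sum>(j, k)\<in>B - P. cmod (t j k))) \<le> 6 * \<eta> * (16 * A)"
      using \<eta> A(1) by simp
    also have "\<dots> = d * (6 * (\<epsilon> / 2))" using A(1) by (simp add: \<eta>_def)
    finally have le: "w x * (\<Sum>(j, k)\<in>B - P. cmod (t j k)) \<le> 6 * (\<epsilon> / 2)" using d by simp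
    have "6 * (cmod (f x - a x) * w x) \<le> 2 * pi * (cmod (f x - a x) * w x)"
      using pi_gt3 wx by (intro mult_right_mono) auto
    also have "\<dots> = w x * (2 * pi * cmod (f x - a x))" by simp
    also have "\<dots> \<le> w x * (\<Sum>(j, k)\<in>B - P. cmod (t j k))" by (rule mult_left_mono[OF diff wx])
    finally show ?thesis using le by linarith
  qed
  show "\<exists>a\<in>H. \<forall>x\<in>S. cmod (f x - a x) * w x \<le> \<epsilon>"
  proof (intro bexI[OF _ b(1)] ballI)
    fix x assume x: "x \<in> S"
    show "cmod (f x - b x) * w x \<le> \<epsilon>"
    proof (rule ccontr)
      assume "\<not> cmod (f x - b x) * w x \<le> \<epsilon>"
      define Z where "Z = {y \<in> S. \<epsilon> < cmod (f y - b y) * w y}"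
      have "S \<subseteq> W" using d0 by force
      then have "continuous_on S (\<lambda>y. cmod (f y - b y) * w y)"
        by (intro continuous_intros H[OF b(1)] w continuous_on_subset[OF holomorphic_on_imp_continuous_on[OF f]])
      then have "open (S \<inter> (\<lambda>y. cmod (f y - b y) * w y) -` {\<epsilon><..})"
        using continuous_open_preimage[OF _ S] open_greaterThan by blast
      moreover have "Z = S \<inter> (\<lambda>y. cmod (f y - b y) * w y) -` {\<epsilon><..}" by (auto simp: Z_def)
      ultimately have "open Z" by simp
      moreover have "x \<in> Z" using x \<open>\<not> _ \<le> \<epsilon>\<close> by (simp add: Z_def)
      ultimately obtain r where r: "0 < r" "ball x r \<subseteq> Z" by (meson open_contains_ball)
      obtain y where y: "dist x y < r" "\<And>j. Re y \<noteq> d * of_int j" "\<And>k. Im y \<noteq> d * of_int k"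
        using off_grid_point_near[OF d r(1)] by metis
      then have yZ: "y \<in> S" "\<epsilon> < cmod (f y - b y) * w y" using r by (auto simp: Z_def subset_iff)
      have "cmod (f y - b y) \<le> cmod (f y - a y) + cmod (a y - b y)"
        using norm_triangle_ineq[of "f y - a y" "a y - b y"] by simp
      then have "cmod (f y - b y) * w y \<le> (cmod (f y - a y) + cmod (a y - b y)) * w y"
        by (rule mult_right_mono) (rule weight_nonneg[OF yZ(1)])
      then show False
        using main[OF yZ(1) y(2,3)] b(2)[OF yZ(1)] yZ(2) by (simp add: distrib_right)
    qed
  qed
qed

end

section \<open>Estimates for the kernel\<close>

text \<open>
  The integral bound on compact sets becomes a locally uniform bound in the pole, because the kernel is
  holomorphic in the pole away from \<open>x\<close>.
\<close>
lemma kernel_locally_bounded: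
  fixes g :: "complex \<Rightarrow> complex" and w :: "complex \<Rightarrow> real"
  assumes g: "g holomorphic_on UNIV" and w: "\<And>x. x \<in> S \<Longrightarrow> 0 \<le> w x"
    and int: "\<And>K. compact K \<Longrightarrow> \<exists>A>0. \<forall>x\<in>S.
      (\<integral>\<^sup>+y\<in>K. ennreal (cmod (g (x - y)) * w x / cmod (x - y)) \<partial>lborel) \<le> ennreal A"
    and y: "y \<in> - closure S"
  shows "\<exists>\<rho>>0. \<exists>M. cball y \<rho> \<subseteq> - closure S \<and>
    (\<forall>z\<in>cball y \<rho>. \<forall>x\<in>S. cmod (g (x - z) / (x - z)) * w x \<le> M)"
proof -
  obtain e where e: "0 < e" "ball y e \<subseteq> - closure S"
    using y open_contains_ball[of "- closure S"] by blast
  define r where "r = e / 4"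
  have r: "0 < r" using e by (simp add: r_def)
  define K where "K = cball y (3 * r)"
  have KS: "K \<subseteq> - closure S" using e by (auto simp: K_def r_def subset_iff)
  have sub: "cball y r \<subseteq> K" using r by (auto simp: K_def)
  obtain A where A: "0 < A" "\<And>x. x \<in> S \<Longrightarrow>
      (\<integral>\<^sup>+y\<in>K. ennreal (cmod (g (x - y)) * w x / cmod (x - y)) \<partial>lborel) \<le> ennreal A"
    using int[of K] by (auto simp: K_def)
  have "cmod (g (x - z) / (x - z)) * w x \<le> 3 * A / r\<^sup>2" if z: "z \<in> cball y r" and x: "x \<in> S" for z x
  proof -
    define Q where "Q = cbox (z - Complex r r) (z + Complex r r)"
    define G where "G y = of_real (w x) * (g (x - y) / (x - y))" for y
    have QK: "Q \<subseteq> K"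
    proof
      fix q assume "q \<in> Q"
      then have "\<bar>Re (z - q)\<bar> \<le> r" "\<bar>Im (z - q)\<bar> \<le> r"
        by (auto simp: Q_def in_cbox_complex_iff abs_le_iff)
      then have "dist z q \<le> 2 * r" using cmod_le[of "z - q"] by (simp add: dist_norm)
      then show "q \<in> K" using z dist_triangle[of y q z] by (simp add: K_def)
    qed
    have "x \<notin> K" using KS x closure_subset by blast
    then have "G holomorphic_on Q"
      unfolding G_def using QK by (intro holomorphic_intros holomorphic_on_reflect_shift[OF g]) auto
    then have "ennreal (r\<^sup>2 * cmod (G z)) \<le> 3 * (\<integral>\<^sup>+y\<in>Q. ennreal (cmod (G y)) \<partial>lborel)"
      unfolding Q_def by (rule submean_square[OF r])
    also have "\<dots> \<le> 3 * (\<integral>\<^sup>+y\<in>K. ennreal (cmod (g (x - y)) * w x / cmod (x - y)) \<partial>lborel)"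
      using QK w[OF x]
      by (intro mult_left_mono nn_integral_mono) (auto simp: G_def norm_mult norm_divide mult.commute indicator_def)
    also have "\<dots> \<le> 3 * ennreal A" by (intro mult_left_mono A(2)[OF x]) simp
    also have "\<dots> = ennreal (3 * A)" using A(1) by (simp add: ennreal_mult)
    finally have "r\<^sup>2 * cmod (G z) \<le> 3 * A" using A(1) by simp
    then have "cmod (G z) \<le> 3 * A / r\<^sup>2" using r by (simp add: pos_le_divide_eq mult.commute)
    moreover have "cmod (G z) = cmod (g (x - z) / (x - z)) * w x"
      using w[OF x] by (simp add: G_def norm_mult norm_divide)
    ultimately show ?thesis by simp
  qed
  then show ?thesis using r sub KS by (intro exI[of _ r] conjI exI[of _ "3 * A / r\<^sup>2"]) auto
qed

lemma circle_bound_imp_center_bound: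
  fixes g :: "complex \<Rightarrow> complex"
  assumes g: "g holomorphic_on UNIV" and r: "0 < r" and v: "0 \<le> v"
    and le: "(SUP \<zeta>\<in>{\<zeta>. cmod (\<zeta> - c) = r}. cmod (g \<zeta>) * v) \<le> B"
  shows "cmod (g c) * v \<le> B"
proof -
  have "compact {\<zeta>. cmod (\<zeta> - c) = r}"
    using compact_sphere[of c r] by (simp add: sphere_def dist_norm norm_minus_commute)
  then have "compact ((\<lambda>\<zeta>. cmod (g \<zeta>) * v) ` {\<zeta>. cmod (\<zeta> - c) = r})"
    by (intro compact_continuous_image continuous_intros
        continuous_on_subset[OF holomorphic_on_imp_continuous_on[OF g]]) auto
  then have bdd: "bdd_above ((\<lambda>\<zeta>. cmod (g \<zeta>) * v) ` {\<zeta>. cmod (\<zeta> - c) = r})"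
    by (intro bounded_imp_bdd_above compact_imp_bounded)
  have "cmod (g c * of_real v) \<le> B"
  proof (rule maximum_modulus_frontier[where S = "cball c r" and f = "\<lambda>\<zeta>. g \<zeta> * of_real v"])
    show "(\<lambda>\<zeta>. g \<zeta> * complex_of_real v) holomorphic_on interior (cball c r)"
      by (intro holomorphic_intros holomorphic_on_subset[OF g]) auto
    show "continuous_on (closure (cball c r)) (\<lambda>\<zeta>. g \<zeta> * complex_of_real v)"
      by (intro continuous_intros continuous_on_subset[OF holomorphic_on_imp_continuous_on[OF g]]) auto
    fix z assume "z \<in> frontier (cball c r)"
    then have "cmod (z - c) = r" using r by (simp add: dist_norm norm_minus_commute)
    then show "cmod (g z * of_real v) \<le> B"
      using cSUP_upper[OF _ bdd, of z] le v by (simp add: norm_mult)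
  qed (use r in auto)
  then show ?thesis using v by (simp add: norm_mult)
qed

section \<open>The weighted spaces on an exhaustion\<close>

text \<open>
  The same space as \<^const>\<open>weighted_hol\<close> without a convention about values outside of \<open>S\<close>, so that it is closed
  under addition and functions can be reused on smaller sets.
\<close>
definition bounded_hol :: "complex set \<Rightarrow> (complex \<Rightarrow> real) \<Rightarrow> (complex \<Rightarrow> complex) set" where
  "bounded_hol S w = {f. f holomorphic_on S \<and> (\<exists>C. \<forall>x\<in>S. cmod (f x) * w x \<le> C)}"

lemma weighted_norm_less_top_iff:
  "weighted_norm S w f < \<infinity> \<longleftrightarrow> (\<exists>C. \<forall>x\<in>S. cmod (f x) * w x \<le> C)"
proof
  assume "weighted_norm S w f < \<infinity>"
  then obtain C where "weighted_norm S w f < ereal C"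
    using less_PInf_Ex_of_nat by auto
  then have "ereal (cmod (f x) * w x) \<le> ereal C" if "x \<in> S" for x
    using that SUP_upper[OF that, of "\<lambda>x. ereal (cmod (f x) * w x)"] unfolding weighted_norm_def by order
  then show "\<exists>C. \<forall>x\<in>S. cmod (f x) * w x \<le> C" by auto
next
  assume "\<exists>C. \<forall>x\<in>S. cmod (f x) * w x \<le> C"
  then obtain C where "\<And>x. x \<in> S \<Longrightarrow> cmod (f x) * w x \<le> C" by blast
  then have "weighted_norm S w f \<le> ereal C" unfolding weighted_norm_def by (intro SUP_least) simp
  then show "weighted_norm S w f < \<infinity>" by auto
qed

lemma weighted_hol_eq: "weighted_hol S w = extensional S \<inter> bounded_hol S w"
  unfolding weighted_hol_def bounded_hol_def weighted_norm_less_top_iff by auto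

lemma restrict_mem_weighted_hol_iff: "restrict f S \<in> weighted_hol S w \<longleftrightarrow> f \<in> bounded_hol S w"
proof -
  have "restrict f S holomorphic_on S \<longleftrightarrow> f holomorphic_on S"
    by (rule holomorphic_cong) auto
  then show ?thesis by (simp add: weighted_hol_eq bounded_hol_def)
qed

text \<open>
  A disc that meets \<open>T\<close> without being contained in \<open>T\<close> meets the frontier of \<open>T\<close>.
\<close>
lemma ball_subset_of_set_distance:
  assumes sub: "S \<subseteq> T" and T: "open T" and pos: "0 < set_distance norm S (frontier T)"
  obtains d where "0 < d" "\<And>x. x \<in> S \<Longrightarrow> ball x d \<subseteq> T"
proof -
  obtain d where d: "0 < ereal d" "ereal d < set_distance norm S (frontier T)"
    using ereal_dense2[OF pos] by blast
  have "ball x d \<subseteq> T" if x: "x \<in> S" for x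
  proof (rule ccontr)
    assume "\<not> ball x d \<subseteq> T"
    moreover have "x \<in> ball x d \<inter> T" using x sub d(1) by auto
    ultimately have "ball x d - T \<noteq> {}" "ball x d \<inter> T \<noteq> {}" by blast+
    then have "ball x d \<inter> frontier T \<noteq> {}"
      by (intro connected_Int_frontier connected_ball)
    then obtain y where y: "dist x y < d" "y \<in> frontier T" by auto
    have "set_distance norm S (frontier T) \<le> ereal (cmod (x - y))"
      unfolding set_distance_def by (intro INF_lower2[OF x] INF_lower2[OF y(2)] order_refl)
    then have "ereal d < ereal (cmod (x - y))" using d(2) by order
    then show False using y(1) by (simp add: dist_norm)
  qed
  then show thesis using that d(1) by auto
qed

locale weighted_exhaustion =
  fixes \<Omega> :: "complex set" and \<Omega>s :: "nat \<Rightarrow> complex set" and \<nu> :: "nat \<Rightarrow> complex \<Rightarrow> real"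
  assumes layers: "\<And>k. k \<ge> 1 \<Longrightarrow> open (\<Omega>s k) \<and> \<Omega>s k \<subseteq> \<Omega>s (k + 1)"
    and exhaust: "\<Omega> = (\<Union>k\<in>{1..}. \<Omega>s k)"
    and weights: "directed_weights \<Omega> \<nu>"
begin

lemma open_layer: "1 \<le> k \<Longrightarrow> open (\<Omega>s k)"
  using layers by blast

lemma layer_subset: "1 \<le> k \<Longrightarrow> \<Omega>s k \<subseteq> \<Omega>"
  using exhaust by auto

lemma layer_mono: assumes "1 \<le> i" "i \<le> j" shows "\<Omega>s i \<subseteq> \<Omega>s j"
  using assms(2)
proof (induction j rule: dec_induct)
  case (step j)
  then show ?case using layers[of j] assms(1) by auto
qed simp

lemma weight_pos: "1 \<le> k \<Longrightarrow> x \<in> \<Omega> \<Longrightarrow> 0 < \<nu> k x"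
  using weights by (simp add: directed_weights_def)

lemma weight_mono: assumes "1 \<le> i" "i \<le> j" "x \<in> \<Omega>" shows "\<nu> i x \<le> \<nu> j x"
  using assms(2)
proof (induction j rule: dec_induct)
  case (step j)
  then have "\<nu> j x \<le> \<nu> (j + 1) x" using weights assms by (simp add: directed_weights_def)
  with step show ?case by simp
qed simp

lemma continuous_weight: "1 \<le> k \<Longrightarrow> S \<subseteq> \<Omega> \<Longrightarrow> continuous_on S (\<nu> k)"
  using weights continuous_on_subset unfolding directed_weights_def by blast

lemma bounded_hol_mono:
  assumes ij: "1 \<le> i" "i \<le> j" and f: "f \<in> bounded_hol (\<Omega>s j) (\<nu> j)"
  shows "f \<in> bounded_hol (\<Omega>s i) (\<nu> i)"
proof -
  note sub = layer_mono[OF ij]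
  obtain C where C: "\<And>x. x \<in> \<Omega>s j \<Longrightarrow> cmod (f x) * \<nu> j x \<le> C"
    using f by (auto simp: bounded_hol_def)
  have "cmod (f x) * \<nu> i x \<le> C" if "x \<in> \<Omega>s i" for x
  proof -
    have "cmod (f x) * \<nu> i x \<le> cmod (f x) * \<nu> j x"
      using layer_subset[OF ij(1)] that by (intro mult_left_mono weight_mono ij) auto
    then show ?thesis using C[of x] sub that by auto
  qed
  moreover have "f holomorphic_on \<Omega>s i" using f sub by (auto simp: bounded_hol_def intro: holomorphic_on_subset)
  ultimately show ?thesis by (auto simp: bounded_hol_def)
qed

lemma weighted_closure_bounded_hol:
  assumes "1 \<le> n" "1 \<le> k"
  shows "weighted_closure (bounded_hol (\<Omega>s k) (\<nu> k)) (\<Omega>s n) (\<nu> n)"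
proof
  show "(\<lambda>x. 0) \<in> bounded_hol (\<Omega>s k) (\<nu> k)" by (auto simp: bounded_hol_def)
  have pos: "0 \<le> \<nu> k x" if "x \<in> \<Omega>s k" for x
    using weight_pos[OF assms(2)] layer_subset[OF assms(2)] that by (meson less_imp_le subsetD)
  fix a b :: "complex \<Rightarrow> complex" and c
  assume a: "a \<in> bounded_hol (\<Omega>s k) (\<nu> k)"
  then obtain C where C: "\<And>x. x \<in> \<Omega>s k \<Longrightarrow> cmod (a x) * \<nu> k x \<le> C" by (auto simp: bounded_hol_def)
  have "cmod (c * a x) * \<nu> k x \<le> cmod c * C" if "x \<in> \<Omega>s k" for x
    using mult_left_mono[OF C[OF that] norm_ge_zero[of c]] by (simp add: norm_mult mult.assoc)
  then show "(\<lambda>x. c * a x) \<in> bounded_hol (\<Omega>s k) (\<nu> k)"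
    using a by (auto simp: bounded_hol_def intro!: holomorphic_intros)
  assume b: "b \<in> bounded_hol (\<Omega>s k) (\<nu> k)"
  then obtain D where D: "\<And>x. x \<in> \<Omega>s k \<Longrightarrow> cmod (b x) * \<nu> k x \<le> D" by (auto simp: bounded_hol_def)
  have "cmod (a x + b x) * \<nu> k x \<le> C + D" if "x \<in> \<Omega>s k" for x
    using mult_right_mono[OF norm_triangle_ineq[of "a x" "b x"] pos[OF that]] C[OF that] D[OF that]
    by (simp add: distrib_right)
  then show "(\<lambda>x. a x + b x) \<in> bounded_hol (\<Omega>s k) (\<nu> k)"
    using a b by (auto simp: bounded_hol_def intro!: holomorphic_intros)
next
  show "0 \<le> \<nu> n x" if "x \<in> \<Omega>s n" for x
    using weight_pos[OF assms(1)] layer_subset[OF assms(1)] that by (meson less_imp_le subsetD)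
qed

text \<open>
  With \<open>q = I\<^sub>4 n\<close>, \<open>p = I\<^sub>1 q\<close> and \<open>l = I\<^sub>2 p\<close>: the decay of \<open>\<nu> q\<close> relative to \<open>\<nu> p\<close> makes \<open>f\<close> small
  outside of compact sets, \<open>condition_D_b\<close> bounds the kernel integrals, and \<open>condition_D_c\<close> connects every pole off the
  closure of \<open>\<Omega>s n\<close> with a pole in \<open>X p\<close>. For poles in \<open>X p\<close> the kernel is itself in the target space, by the
  circle bound in \<open>condition_D_a\<close> and the maximum modulus principle.
\<close>
lemma runge_step:
  assumes D: "condition_D \<Omega>s \<nu> g I\<^sub>1 I\<^sub>2 I\<^sub>4 X" and n: "1 \<le> n"
    and f: "f \<in> bounded_hol (\<Omega>s (I\<^sub>1 (I\<^sub>4 n))) (\<nu> (I\<^sub>1 (I\<^sub>4 n)))"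
  shows "approx_in (bounded_hol (\<Omega>s (I\<^sub>2 (I\<^sub>1 (I\<^sub>4 n)))) (\<nu> (I\<^sub>2 (I\<^sub>1 (I\<^sub>4 n))))) (\<Omega>s n) (\<nu> n) f"
proof -
  have Da: "condition_D_a \<Omega>s \<nu> g I\<^sub>1 I\<^sub>2 X" and Db: "condition_D_b \<Omega>s \<nu> g I\<^sub>1 I\<^sub>4"
    and Dc: "condition_D_c \<Omega>s I\<^sub>1 I\<^sub>4 X"
    and Dd: "\<And>i k. 1 \<le> i \<Longrightarrow> i < k \<Longrightarrow> 0 < set_distance norm (\<Omega>s i) (frontier (\<Omega>s k))"
    using D by (auto simp: condition_D_def)
  define q p l where "q = I\<^sub>4 n" and "p = I\<^sub>1 q" and "l = I\<^sub>2 p"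
  have nq: "n < q" using Db n by (simp add: condition_D_b_def q_def)
  have qp: "q < p" using Da nq n by (auto simp: condition_D_a_def p_def)
  have pl: "p < l" using Da nq qp n by (auto simp: condition_D_a_def l_def)
  have pos: "1 \<le> q" "1 \<le> p" "1 \<le> l" using n nq qp pl by auto
  have gp: "g p holomorphic_on UNIV" "g p 0 = 1" using Da pos by (auto simp: condition_D_a_def)
  define H where "H = bounded_hol (\<Omega>s l) (\<nu> l)"
  interpret weighted_closure H "\<Omega>s n" "\<nu> n"
    unfolding H_def by (rule weighted_closure_bounded_hol) (use n pos in auto)
  obtain C where C: "\<And>x. x \<in> \<Omega>s p \<Longrightarrow> cmod (f x) * \<nu> p x \<le> C" and fhol: "f holomorphic_on \<Omega>s p"
    using f by (auto simp: bounded_hol_def p_def q_def)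
  have sub: "\<Omega>s n \<subseteq> \<Omega>s q" "\<Omega>s q \<subseteq> \<Omega>s p" "\<Omega>s p \<subseteq> \<Omega>s l"
    using layer_mono n nq qp pl by auto
  obtain d where d: "0 < d" "\<And>x. x \<in> \<Omega>s n \<Longrightarrow> ball x d \<subseteq> \<Omega>s q"
    using ball_subset_of_set_distance[OF sub(1) open_layer[OF pos(1)] Dd[OF n nq]] by blast
  have bdd: "\<exists>\<rho>>0. \<exists>M. cball y \<rho> \<subseteq> - closure (\<Omega>s n) \<and>
        (\<forall>z\<in>cball y \<rho>. \<forall>x\<in>\<Omega>s n. cmod (g p (x - z) / (x - z)) * \<nu> n x \<le> M)"
    if y: "y \<in> - closure (\<Omega>s n)" for y
  proof -
    have in\<Omega>: "x \<in> \<Omega>" if "x \<in> \<Omega>s n" for x using that layer_subset[OF n] by blast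
    have "\<exists>\<rho>>0. \<exists>M. cball y \<rho> \<subseteq> - closure (\<Omega>s n) \<and>
        (\<forall>z\<in>cball y \<rho>. \<forall>x\<in>\<Omega>s n. cmod (g p (x - z) / (x - z)) * \<nu> p x \<le> M)"
    proof (rule kernel_locally_bounded[OF gp(1) _ _ y])
      show "0 \<le> \<nu> p x" if "x \<in> \<Omega>s n" for x using weight_pos[OF pos(2) in\<Omega>[OF that]] by simp
      fix K :: "complex set" assume "compact K"
      then obtain A where "0 < A" "\<forall>x\<in>\<Omega>s p. (\<integral>\<^sup>+ y\<in>K. ennreal (cmod (g p (x - y)) * \<nu> p x / cmod (x - y)) \<partial>lborel) \<le> ennreal A"
        using Da pos(2) unfolding condition_D_a_def by meson
      then show "\<exists>A>0. \<forall>x\<in>\<Omega>s n. (\<integral>\<^sup>+ y\<in>K. ennreal (cmod (g p (x - y)) * \<nu> p x / cmod (x - y)) \<partial>lborel) \<le> ennreal A"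
        using sub by blast
    qed
    then obtain \<rho> M where "0 < \<rho>" "cball y \<rho> \<subseteq> - closure (\<Omega>s n)"
      and M: "\<And>z x. z \<in> cball y \<rho> \<Longrightarrow> x \<in> \<Omega>s n \<Longrightarrow> cmod (g p (x - z) / (x - z)) * \<nu> p x \<le> M" by blast
    moreover have "cmod (g p (x - z) / (x - z)) * \<nu> n x \<le> M" if "z \<in> cball y \<rho>" "x \<in> \<Omega>s n" for z x
      using M[OF that] mult_left_mono[OF weight_mono[of n p x] norm_ge_zero[of "g p (x - z) / (x - z)"]]
        in\<Omega>[OF that(2)] n nq qp by force
    ultimately show ?thesis by blast
  qed
  have pole_X: "(\<lambda>x. g p (x - y) / (x - y)) \<in> H" if y: "y \<in> X p" for y
  proof -
    from Da pos(2) obtain R r A2 where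
      XR: "X p \<subseteq> - closure (\<Omega>s l)" "0 < 2 * R" "ereal (2 * R) < set_distance norm (X p) (\<Omega>s l)" "R < r"
      and A2: "\<And>z x. z \<in> \<Omega>s l \<Longrightarrow> x \<in> X p + ball 0 R \<Longrightarrow>
         (SUP \<zeta>\<in>{\<zeta>. cmod (\<zeta> - (z - x)) = r}. cmod (g p \<zeta>) * \<nu> l z) \<le> A2 x"
      unfolding condition_D_a_def l_def by meson
    have "y + 0 \<in> X p + ball 0 R" using y XR(2) by (intro set_plus_intro) auto
    then have yR: "y \<in> X p + ball 0 R" by simp
    have "cmod (g p (x - y) / (x - y)) * \<nu> l x \<le> A2 y / (2 * R)" if x: "x \<in> \<Omega>s l" for x
    proof -
      have v: "0 \<le> \<nu> l x" using weight_pos[OF pos(3)] layer_subset[OF pos(3)] x by (meson less_imp_le subsetD)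
      have le: "cmod (g p (x - y)) * \<nu> l x \<le> A2 y"
        by (rule circle_bound_imp_center_bound[OF gp(1) _ v A2[OF x yR]]) (use XR in auto)
      have "set_distance norm (X p) (\<Omega>s l) \<le> ereal (cmod (y - x))"
        unfolding set_distance_def by (intro INF_lower2[OF y] INF_lower2[OF x] order_refl)
      then have "ereal (2 * R) < ereal (cmod (y - x))" using XR(3) by order
      then have "2 * R \<le> cmod (x - y)" by (simp add: norm_minus_commute)
      then have "cmod (g p (x - y)) * \<nu> l x / cmod (x - y) \<le> A2 y / (2 * R)"
      proof (intro frac_le)
        show "0 \<le> A2 y" using le mult_nonneg_nonneg[OF norm_ge_zero v, of "g p (x - y)"] by linarith
      qed (use le XR(2) in auto)
      then show ?thesis by (simp add: norm_divide)
    qed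
    moreover have "(\<lambda>x. g p (x - y) / (x - y)) holomorphic_on \<Omega>s l"
    proof -
      have "y \<notin> \<Omega>s l" using XR(1) y closure_subset by blast
      moreover have "(\<lambda>x. g p (x - y)) holomorphic_on \<Omega>s l"
        using holomorphic_on_compose_gen[of "\<lambda>x. x - y" "\<Omega>s l" "g p" UNIV] gp(1)
        by (simp add: o_def holomorphic_intros)
      ultimately show ?thesis by (intro holomorphic_intros) auto
    qed
    ultimately show ?thesis unfolding H_def bounded_hol_def by blast
  qed
  have pole: "apx (\<lambda>x. g p (x - y) / (x - y))" if y: "y \<in> - closure (\<Omega>s n)" for y
  proof -
    obtain N where N: "N \<in> components (- closure (\<Omega>s n))" "y \<in> N"
      using y Union_components[of "- closure (\<Omega>s n)"] by blast
    have "N \<subseteq> - closure (\<Omega>s n)" using N(1) by (rule in_components_subset)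
    then have "N \<inter> - closure (\<Omega>s n) \<noteq> {}" using N(2) by blast
    then have meet: "N \<inter> X p \<noteq> {}"
      using Dc n N(1) unfolding condition_D_c_def p_def q_def by blast
    show ?thesis
    proof (rule apx_component[where U = "- closure (\<Omega>s n)" and N = N and V = "X p" and y = y
          and E = "\<lambda>y x. g p (x - y) / (x - y)"])
      show "(\<lambda>y. g p (x - y) / (x - y)) holomorphic_on - closure (\<Omega>s n)" if "x \<in> \<Omega>s n" for x
        using that closure_subset by (intro holomorphic_intros holomorphic_on_reflect_shift[OF gp(1)]) auto
      show "open (X p)" using Da pos(2) by (auto simp: condition_D_a_def)
    qed (use bdd N meet pole_X in \<open>auto intro: apx_mem\<close>)
  qed
  obtain A where A: "0 < A" "\<And>x. x \<in> \<Omega>s n \<Longrightarrow>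
      (\<integral>\<^sup>+y\<in>\<Omega>s q. ennreal (cmod (g p (x - y)) * \<nu> n x / (cmod (x - y) * \<nu> q y)) \<partial>lborel) \<le> ennreal A"
    using Db n unfolding condition_D_b_def p_def q_def by blast
  have "apx f"
  proof (rule apx_restrict_holomorphic[OF open_layer[OF n] open_layer[OF pos(1)] d gp
        holomorphic_on_subset[OF fhol sub(2)] _ _ _ _ A _ bdd pole])
    show "continuous_on (\<Omega>s q) (\<nu> q)" "continuous_on (\<Omega>s n) (\<nu> n)"
      using n pos layer_subset by (auto intro!: continuous_weight)
    show "0 < \<nu> q y" if "y \<in> \<Omega>s q" for y using that weight_pos layer_subset pos by blast
    show "continuous_on (\<Omega>s n) a" if "a \<in> H" for a
      using that sub unfolding H_def bounded_hol_def
      by (auto intro!: holomorphic_on_imp_continuous_on intro: holomorphic_on_subset)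
    fix \<eta> :: real assume \<eta>: "0 < \<eta>"
    \<comment> \<open>\<open>C\<close> itself could be 0 or negative.\<close>
    define C' where "C' = max C 1"
    have "0 < \<eta> / C'" using \<eta> by (simp add: C'_def)
    then obtain K where K: "compact K" "\<And>x. x \<in> \<Omega>s q - K \<Longrightarrow> \<nu> q x \<le> \<eta> / C' * \<nu> p x"
      using Da pos(1) unfolding condition_D_a_def p_def by meson
    have "cmod (f y) * \<nu> q y \<le> \<eta>" if y: "y \<in> \<Omega>s q - K" for y
    proof -
      have "cmod (f y) * \<nu> q y \<le> cmod (f y) * (\<eta> / C' * \<nu> p y)"
        by (intro mult_left_mono K y) simp
      also have "\<dots> = \<eta> / C' * (cmod (f y) * \<nu> p y)" by simp
      also have "\<dots> \<le> \<eta> / C' * C'"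
        using C[of y] y sub \<eta> by (intro mult_left_mono) (auto simp: C'_def)
      also have "\<dots> = \<eta>" by (simp add: C'_def)
      finally show ?thesis .
    qed
    then show "\<exists>K. compact K \<and> (\<forall>y\<in>\<Omega>s q - K. cmod (f y) * \<nu> q y \<le> \<eta>)" using K(1) by blast
  qed auto
  then show ?thesis by (simp add: H_def l_def p_def q_def)
qed

text \<open>
  The Mittag-Leffler procedure: correct \<open>f\<close> successively by errors of size \<open>\<epsilon> / 2 ^ Suc i\<close> in the norm of
  layer \<open>n + i\<close>. The weights grow, so on a fixed layer all later errors are summable in its own norm.
\<close>
lemma mittag_leffler_density:
  assumes J: "\<And>k. k \<le> J k" and n: "1 \<le> n"
    and step: "\<And>k f. 1 \<le> k \<Longrightarrow> f \<in> bounded_hol (\<Omega>s (J k)) (\<nu> (J k)) \<Longrightarrow>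
      approx_in (bounded_hol (\<Omega>s (J (k + 1))) (\<nu> (J (k + 1)))) (\<Omega>s k) (\<nu> k) f"
    and f: "f \<in> bounded_hol (\<Omega>s (J n)) (\<nu> (J n))" and e: "0 < \<epsilon>"
  obtains F where "F holomorphic_on \<Omega>" "\<And>k. 1 \<le> k \<Longrightarrow> F \<in> bounded_hol (\<Omega>s k) (\<nu> k)"
    "\<And>x. x \<in> \<Omega>s n \<Longrightarrow> cmod (f x - F x) * \<nu> n x \<le> \<epsilon>"
proof -
  have "\<exists>s. \<forall>i. (s i \<in> bounded_hol (\<Omega>s (J (n + i))) (\<nu> (J (n + i))) \<and> (i = 0 \<longrightarrow> s i = f)) \<and>
      (\<forall>x\<in>\<Omega>s (n + i). cmod (s i x - s (Suc i) x) * \<nu> (n + i) x \<le> \<epsilon> / 2 ^ Suc i)"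
  proof (rule dependent_nat_choice)
    show "\<exists>h. h \<in> bounded_hol (\<Omega>s (J (n + 0))) (\<nu> (J (n + 0))) \<and> (0 = 0 \<longrightarrow> h = f)" using f by auto
    fix h i assume h: "h \<in> bounded_hol (\<Omega>s (J (n + i))) (\<nu> (J (n + i))) \<and> (i = 0 \<longrightarrow> h = f)"
    have "0 < \<epsilon> / 2 ^ Suc i" using e by simp
    then show "\<exists>a. (a \<in> bounded_hol (\<Omega>s (J (n + Suc i))) (\<nu> (J (n + Suc i))) \<and> (Suc i = 0 \<longrightarrow> a = f)) \<and>
      (\<forall>x\<in>\<Omega>s (n + i). cmod (h x - a x) * \<nu> (n + i) x \<le> \<epsilon> / 2 ^ Suc i)"
      using step[of "n + i" h] h n unfolding approx_in_def by fastforce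
  qed
  then obtain s where s: "\<And>i. s i \<in> bounded_hol (\<Omega>s (J (n + i))) (\<nu> (J (n + i)))" "s 0 = f"
    and near: "\<And>i x. x \<in> \<Omega>s (n + i) \<Longrightarrow> cmod (s i x - s (Suc i) x) * \<nu> (n + i) x \<le> \<epsilon> / 2 ^ Suc i"
    by metis
  have mem: "s i \<in> bounded_hol (\<Omega>s (n + l)) (\<nu> (n + l))" if "l \<le> i" for i l
    by (rule bounded_hol_mono[OF _ _ s(1)[of i]]) (use n that J[of "n + i"] in auto)
  have in\<Omega>: "x \<in> \<Omega>" if "x \<in> \<Omega>s (n + l)" for x l using that layer_subset[of "n + l"] n by auto
  have tele: "cmod (s i x - s j x) * \<nu> (n + l) x \<le> \<epsilon> / 2 ^ i - \<epsilon> / 2 ^ j"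
    if x: "x \<in> \<Omega>s (n + l)" and l: "l \<le> i" and ij: "i \<le> j" for x i j l
    using ij
  proof (induction j rule: dec_induct)
    case (step j)
    have v: "0 \<le> \<nu> (n + l) x" using weight_pos[of "n + l" x] in\<Omega>[OF x] n by simp
    have "x \<in> \<Omega>s (n + j)" using x layer_mono[of "n + l" "n + j"] n l step by auto
    from near[OF this] have "cmod (s j x - s (Suc j) x) * \<nu> (n + j) x \<le> \<epsilon> / 2 ^ Suc j" .
    moreover have "cmod (s j x - s (Suc j) x) * \<nu> (n + l) x \<le> cmod (s j x - s (Suc j) x) * \<nu> (n + j) x"
      using n l step in\<Omega>[OF x] by (intro mult_left_mono weight_mono) auto
    moreover have "cmod (s i x - s (Suc j) x) * \<nu> (n + l) x
        \<le> (cmod (s i x - s j x) + cmod (s j x - s (Suc j) x)) * \<nu> (n + l) x"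
      using norm_triangle_ineq[of "s i x - s j x" "s j x - s (Suc j) x"] by (intro mult_right_mono v) simp
    ultimately have "cmod (s i x - s (Suc j) x) * \<nu> (n + l) x \<le> \<epsilon> / 2 ^ i - \<epsilon> / 2 ^ j + \<epsilon> / 2 ^ Suc j"
      using step.IH by (simp add: distrib_right)
    also have "\<dots> = \<epsilon> / 2 ^ i - \<epsilon> / 2 ^ Suc j" by (simp add: field_simps)
    finally show ?case .
  qed simp
  have tele': "cmod (s i x - s j x) * \<nu> (n + l) x \<le> \<epsilon> / 2 ^ i"
    if "x \<in> \<Omega>s (n + l)" "l \<le> i" "i \<le> j" for x i j l
    using tele[OF that] e by (smt (verit) divide_pos_pos zero_less_power)
  have half: "(\<lambda>i. \<epsilon> / 2 ^ i / c) \<longlonglongrightarrow> 0" for c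
  proof -
    have "(\<lambda>i. \<epsilon> / c * (1 / 2) ^ i) \<longlonglongrightarrow> \<epsilon> / c * 0"
      by (intro tendsto_intros LIMSEQ_realpow_zero) auto
    moreover have "\<epsilon> / c * (1 / 2) ^ i = \<epsilon> / 2 ^ i / c" for i by (simp add: power_one_over)
    ultimately show ?thesis by simp
  qed
  define F where "F x = lim (\<lambda>i. s i x)" for x
  have lim: "(\<lambda>i. s i x) \<longlonglongrightarrow> F x" if x: "x \<in> \<Omega>s (n + l)" for x l
  proof -
    have v: "0 < \<nu> (n + l) x" using weight_pos[of "n + l" x] in\<Omega>[OF x] n by simp
    have "Cauchy (\<lambda>i. s i x)"
    proof (rule metric_CauchyI)
      fix r :: real assume "0 < r"
      then have "eventually (\<lambda>i. \<epsilon> / 2 ^ i / \<nu> (n + l) x < r / 2) sequentially"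
        using half[of "\<nu> (n + l) x"] by (intro order_tendstoD) auto
      then obtain M where M: "\<And>i. M \<le> i \<Longrightarrow> \<epsilon> / 2 ^ i / \<nu> (n + l) x < r / 2"
        by (auto simp: eventually_sequentially)
      define M' where "M' = max M l"
      have "dist (s M' x) (s j x) < r / 2" if "M' \<le> j" for j
      proof -
        have "l \<le> M'" by (simp add: M'_def)
        then have "cmod (s M' x - s j x) \<le> \<epsilon> / 2 ^ M' / \<nu> (n + l) x"
          using tele'[OF x _ that] by (simp only: pos_le_divide_eq[OF v])
        also have "\<dots> < r / 2" by (rule M) (simp add: M'_def)
        finally show ?thesis by (simp only: dist_norm)
      qed
      then show "\<exists>M. \<forall>i\<ge>M. \<forall>j\<ge>M. dist (s i x) (s j x) < r"
        by (meson dist_triangle_half_r)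
    qed
    then show ?thesis by (simp add: F_def convergent_LIMSEQ_iff Cauchy_convergent_iff)
  qed
  have close: "cmod (s i x - F x) * \<nu> (n + l) x \<le> \<epsilon> / 2 ^ i"
    if x: "x \<in> \<Omega>s (n + l)" and l: "l \<le> i" for x i l
  proof (rule Lim_bounded)
    show "(\<lambda>j. cmod (s i x - s j x) * \<nu> (n + l) x) \<longlonglongrightarrow> cmod (s i x - F x) * \<nu> (n + l) x"
      by (intro tendsto_intros lim[OF x])
    show "\<forall>j\<ge>i. cmod (s i x - s j x) * \<nu> (n + l) x \<le> \<epsilon> / 2 ^ i" using tele'[OF x l] by blast
  qed
  have holF: "F holomorphic_on \<Omega>s (n + l)" for l
  proof (rule holomorphic_uniform_sequence[where f = "\<lambda>i. s (i + l)"])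
    show "open (\<Omega>s (n + l))" using open_layer n by simp
    show "s (i + l) holomorphic_on \<Omega>s (n + l)" for i
      using mem[of l "i + l"] by (simp add: bounded_hol_def)
    fix x assume x: "x \<in> \<Omega>s (n + l)"
    obtain d where d: "0 < d" "cball x d \<subseteq> \<Omega>s (n + l)"
      using open_contains_cball[of "\<Omega>s (n + l)"] open_layer[of "n + l"] x n by auto
    \<comment> \<open>On a compact disc the weight is bounded below, so weighted estimates give uniform convergence.\<close>
    have "continuous_on (cball x d) (\<nu> (n + l))"
      using d in\<Omega> n by (intro continuous_weight) auto
    then obtain y where y: "y \<in> cball x d" "\<And>z. z \<in> cball x d \<Longrightarrow> \<nu> (n + l) y \<le> \<nu> (n + l) z"
      using continuous_attains_inf[OF compact_cball, of x d "\<nu> (n + l)"] d by auto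
    define c where "c = \<nu> (n + l) y"
    have c: "0 < c" unfolding c_def using weight_pos[of "n + l" y] in\<Omega> y(1) d(2) n by auto
    have "uniform_limit (cball x d) (\<lambda>i. s (i + l)) F sequentially"
      unfolding uniform_limit_iff
    proof (intro allI impI)
      fix r :: real assume r: "0 < r"
      have "eventually (\<lambda>i. \<epsilon> / 2 ^ i / c < r) sequentially"
        using half[of c] r by (intro order_tendstoD) auto
      then show "\<forall>\<^sub>F i in sequentially. \<forall>z\<in>cball x d. dist (s (i + l) z) (F z) < r"
      proof eventually_elim
        case (elim i)
        show ?case
        proof
          fix z assume z: "z \<in> cball x d"
          have "cmod (s (i + l) z - F z) * c \<le> cmod (s (i + l) z - F z) * \<nu> (n + l) z"
            unfolding c_def by (intro mult_left_mono y(2) z) simp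
          also have "\<dots> \<le> \<epsilon> / 2 ^ (i + l)" using close[of z l "i + l"] z d by auto
          also have "\<dots> \<le> \<epsilon> / 2 ^ i" using e by (intro divide_left_mono power_increasing) auto
          finally have "cmod (s (i + l) z - F z) \<le> \<epsilon> / 2 ^ i / c" by (simp only: pos_le_divide_eq[OF c])
          also note elim
          finally show "dist (s (i + l) z) (F z) < r" by (simp only: dist_norm)
        qed
      qed
    qed
    then show "\<exists>d>0. cball x d \<subseteq> \<Omega>s (n + l) \<and> uniform_limit (cball x d) (\<lambda>i. s (i + l)) F sequentially"
      using d by blast
  qed
  have F_layer: "F \<in> bounded_hol (\<Omega>s (n + l)) (\<nu> (n + l))" for l
  proof -
    obtain C where C: "\<And>x. x \<in> \<Omega>s (n + l) \<Longrightarrow> cmod (s l x) * \<nu> (n + l) x \<le> C"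
      using mem[of l l] by (auto simp: bounded_hol_def)
    have "cmod (F x) * \<nu> (n + l) x \<le> C + \<epsilon> / 2 ^ l" if x: "x \<in> \<Omega>s (n + l)" for x
    proof -
      have "0 \<le> \<nu> (n + l) x" using weight_pos[of "n + l" x] in\<Omega>[OF x] n by simp
      then have "cmod (F x) * \<nu> (n + l) x \<le> (cmod (s l x) + cmod (s l x - F x)) * \<nu> (n + l) x"
        using norm_triangle_ineq4[of "s l x" "s l x - F x"] by (intro mult_right_mono) auto
      then show ?thesis using C[OF x] close[OF x order_refl] by (simp add: distrib_right)
    qed
    then show ?thesis using holF by (auto simp: bounded_hol_def)
  qed
  show thesis
  proof (rule that)
    show Fk: "F \<in> bounded_hol (\<Omega>s k) (\<nu> k)" if "1 \<le> k" for k
      by (rule bounded_hol_mono[OF that _ F_layer[of k]]) simp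
    have "F holomorphic_on (\<Union>k\<in>{1..}. \<Omega>s k)"
      by (rule holomorphic_on_UN_open) (use Fk open_layer in \<open>auto simp: bounded_hol_def\<close>)
    then show "F holomorphic_on \<Omega>" by (simp add: exhaust)
    show "cmod (f x - F x) * \<nu> n x \<le> \<epsilon>" if "x \<in> \<Omega>s n" for x
      using close[of x 0 0] that s(2) by simp
  qed
qed

end

section \<open>Density of the projective limit\<close>

theorem corollary3p6:
  fixes \<Omega> :: "complex set" and \<Omega>s :: "nat \<Rightarrow> complex set"
    and \<nu> :: "nat \<Rightarrow> complex \<Rightarrow> real" and g :: "nat \<Rightarrow> complex \<Rightarrow> complex"
    and I\<^sub>1 I\<^sub>2 I\<^sub>4 :: "nat \<Rightarrow> nat" and J\<^sub>1 :: "nat \<Rightarrow> nat \<Rightarrow> nat"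
    and X :: "nat \<Rightarrow> complex set" and n m :: nat
  assumes "open \<Omega>"
    and "\<And>k. k \<ge> 1 \<Longrightarrow> open (\<Omega>s k) \<and> \<Omega>s k \<noteq> {} \<and> \<Omega>s k \<subseteq> \<Omega>s (k + 1)"
    and "\<Omega> = (\<Union>k\<in>{1..}. \<Omega>s k)"
    and "directed_weights \<Omega> \<nu>"
    and "n \<ge> 1"
    and "condition_D \<Omega>s \<nu> g I\<^sub>1 I\<^sub>2 I\<^sub>4 X"
    and "\<And>k. k \<ge> 1 \<Longrightarrow> I\<^sub>2 (I\<^sub>1 (I\<^sub>4 k)) \<ge> I\<^sub>1 (I\<^sub>4 (k + 1))"
    and "omega_1 \<Omega>s \<nu> J\<^sub>1"
    and "m = 2 * J\<^sub>1 (I\<^sub>1 (I\<^sub>4 n)) (I\<^sub>1 (I\<^sub>4 n))"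
  shows "dense_wrt (weighted_norm (\<Omega>s n) (\<nu> n))
           ((\<lambda>f. restrict f (\<Omega>s n)) ` weighted_hol_proj \<Omega> \<Omega>s \<nu>)
           ((\<lambda>f. restrict f (\<Omega>s n)) ` weighted_hol (\<Omega>s m) (\<nu> m))"
proof -
  interpret weighted_exhaustion \<Omega> \<Omega>s \<nu>
    by unfold_locales (use assms in auto)
  \<comment> \<open>The value at 0 only serves to have \<open>k \<le> J k\<close> for all \<open>k\<close>.\<close>
  define J where "J k = (if k = 0 then 0 else I\<^sub>1 (I\<^sub>4 k))" for k
  have n: "1 \<le> n" by fact
  have Jk: "k \<le> J k" for k
  proof (cases "k = 0")
    case False
    then have "k < I\<^sub>4 k" using assms(6) by (simp add: condition_D_def condition_D_b_def)
    moreover from this have "I\<^sub>4 k < I\<^sub>1 (I\<^sub>4 k)" using assms(6) by (simp add: condition_D_def condition_D_a_def)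
    ultimately show ?thesis by (simp add: J_def)
  qed (simp add: J_def)
  have "1 \<le> J n" using Jk[of n] n by simp
  then have "J n \<le> J\<^sub>1 (J n) (J n)"
    using assms(8) unfolding omega_1_def by blast
  then have m: "J n \<le> m" using n assms(9) by (simp add: J_def)
  have nm: "n \<le> m" "1 \<le> m" using Jk[of n] m n by linarith+
  have step: "approx_in (bounded_hol (\<Omega>s (J (k + 1))) (\<nu> (J (k + 1)))) (\<Omega>s k) (\<nu> k) f"
    if k: "1 \<le> k" and f: "f \<in> bounded_hol (\<Omega>s (J k)) (\<nu> (J k))" for k f
  proof -
    define L where "L = I\<^sub>2 (I\<^sub>1 (I\<^sub>4 k))"
    have "1 \<le> J (k + 1)" "J (k + 1) \<le> L"
      using Jk[of "k + 1"] assms(7)[OF k] by (simp_all add: J_def L_def)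
    then have "bounded_hol (\<Omega>s L) (\<nu> L) \<subseteq> bounded_hol (\<Omega>s (J (k + 1))) (\<nu> (J (k + 1)))"
      using bounded_hol_mono by blast
    moreover have "approx_in (bounded_hol (\<Omega>s L) (\<nu> L)) (\<Omega>s k) (\<nu> k) f"
      unfolding L_def by (rule runge_step[OF assms(6) k]) (use f k in \<open>simp add: J_def\<close>)
    ultimately show ?thesis unfolding approx_in_def by blast
  qed
  have proj: "restrict F \<Omega> \<in> weighted_hol_proj \<Omega> \<Omega>s \<nu>"
    if F: "F holomorphic_on \<Omega>" "\<And>k. 1 \<le> k \<Longrightarrow> F \<in> bounded_hol (\<Omega>s k) (\<nu> k)" for F
  proof -
    have "restrict F \<Omega> holomorphic_on \<Omega>" using F(1) by (simp cong: holomorphic_cong)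
    moreover have "restrict (restrict F \<Omega>) (\<Omega>s k) \<in> weighted_hol (\<Omega>s k) (\<nu> k)" if "1 \<le> k" for k
    proof -
      have "restrict (restrict F \<Omega>) (\<Omega>s k) = restrict F (\<Omega>s k)"
        using layer_subset[OF that] by (auto simp: restrict_def fun_eq_iff)
      then show ?thesis using F(2)[OF that] by (simp add: restrict_mem_weighted_hol_iff)
    qed
    ultimately show ?thesis by (simp add: weighted_hol_proj_def)
  qed
  show ?thesis
    unfolding dense_wrt_def
  proof (intro conjI ballI allI impI subsetI)
    fix u assume "u \<in> (\<lambda>f. restrict f (\<Omega>s n)) ` weighted_hol_proj \<Omega> \<Omega>s \<nu>"
    then obtain F where F: "F \<in> weighted_hol_proj \<Omega> \<Omega>s \<nu>" "u = restrict F (\<Omega>s n)" by blast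
    have "u = restrict (restrict F (\<Omega>s m)) (\<Omega>s n)"
      using F(2) layer_mono[OF n nm(1)] by (auto simp: restrict_def fun_eq_iff)
    moreover have "restrict F (\<Omega>s m) \<in> weighted_hol (\<Omega>s m) (\<nu> m)"
      using F(1) nm(2) by (simp add: weighted_hol_proj_def)
    ultimately show "u \<in> (\<lambda>f. restrict f (\<Omega>s n)) ` weighted_hol (\<Omega>s m) (\<nu> m)" by blast
  next
    fix b and \<epsilon> :: real assume "b \<in> (\<lambda>f. restrict f (\<Omega>s n)) ` weighted_hol (\<Omega>s m) (\<nu> m)" and e: "0 < \<epsilon>"
    then obtain f where f: "f \<in> weighted_hol (\<Omega>s m) (\<nu> m)" and b: "b = restrict f (\<Omega>s n)" by blast
    have "f \<in> bounded_hol (\<Omega>s (J n)) (\<nu> (J n))"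
      using f bounded_hol_mono[OF \<open>1 \<le> J n\<close> m] by (simp add: weighted_hol_eq)
    then obtain F where F: "F holomorphic_on \<Omega>" "\<And>k. 1 \<le> k \<Longrightarrow> F \<in> bounded_hol (\<Omega>s k) (\<nu> k)"
      "\<And>x. x \<in> \<Omega>s n \<Longrightarrow> cmod (f x - F x) * \<nu> n x \<le> \<epsilon> / 2"
      using mittag_leffler_density[OF Jk n step _ half_gt_zero[OF e]] by metis
    have "weighted_norm (\<Omega>s n) (\<nu> n) (\<lambda>x. b x - restrict (restrict F \<Omega>) (\<Omega>s n) x) \<le> ereal (\<epsilon> / 2)"
      unfolding weighted_norm_def
    proof (rule SUP_least)
      fix x assume x: "x \<in> \<Omega>s n"
      then have "x \<in> \<Omega>" using layer_subset[OF n] by blast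
      then show "ereal (cmod (b x - restrict (restrict F \<Omega>) (\<Omega>s n) x) * \<nu> n x) \<le> ereal (\<epsilon> / 2)"
        using F(3)[OF x] x b by simp
    qed
    also have "\<dots> < ereal \<epsilon>" using e by simp
    finally show "\<exists>a\<in>(\<lambda>f. restrict f (\<Omega>s n)) ` weighted_hol_proj \<Omega> \<Omega>s \<nu>.
        weighted_norm (\<Omega>s n) (\<nu> n) (\<lambda>x. b x - a x) < ereal \<epsilon>"
      using proj[OF F(1,2)] by blast
  qed
qed

end
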